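(* Let $x: M^n \to E^{n+1}$ be an isometric immersion of an $n$-dimensional Riemannian manifold $(M^n,g)$ as a hypersurface of the Euclidean space $E^{n+1}$. Suppose that $M^n$ is a biharmonic hypersurface and that its curvature operator $R$ is recurrent, i.e. there exists a $1$-form $\eta$ on $M^n$ such that $(\nabla_X R)(Y,Z)W=\eta(X)\,R(Y,Z)W$ for all $X,Y,Z,W$ tangent to $M^n$. Then $M^n$ is minimal.
   Context: $\nabla$ is the Levi-Civita connection of $(M^n,g)$ and $R$ its Riemann curvature tensor. A tensor field $T$ on $M^n$ is called recurrent if there is a $1$-form $\eta$ on $M^n$ with $\nabla_X T=\eta(X)T$ for every $X$ tangent to $M^n$. Let $N$ be a local unit normal field, $A$ the shape (Weingarten) operator, and $\overrightarrow{H}=HN$ the mean curvature vector field, where $nH=\mathrm{trace}\,A$. The Laplacian is $\Delta=-\mathrm{trace}\,\nabla^2$, so that $\Delta x=-n\overrightarrow{H}$ (applied componentwise to $E^{n+1}$-valued functions). The hypersurface is biharmonic if $\Delta \overrightarrow{H}=0$; equivalently, $\Delta^{\perp}H+H\,\mathrm{trace}A^2=0$ and $2A(\mathrm{grad}\,H)+nH\,\mathrm{grad}\,H=0$, where $\Delta^{\perp}$ is the Laplacian in the normal bundle. Minimal means $H\equiv 0$. *)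

theory Defs
  imports "HOL-Analysis.Analysis"
begin

subsection \<open>Smooth maps between Euclidean spaces\<close>

abbreviation dir_deriv ::
  "('a::real_normed_vector \<Rightarrow> 'b::real_normed_vector) \<Rightarrow> 'a \<Rightarrow> 'a \<Rightarrow> 'b"
  where "dir_deriv f u v \<equiv> frechet_derivative f (at u) v"

text \<open>Only used for open \<open>U\<close>, since derivatives are taken at full neighbourhoods.\<close>

primrec Ck_on ::
  "nat \<Rightarrow> 'a::euclidean_space set \<Rightarrow> ('a \<Rightarrow> 'b::real_normed_vector) \<Rightarrow> bool"
  where
    "Ck_on 0 U f \<longleftrightarrow> continuous_on U f"
  | "Ck_on (Suc k) U f \<longleftrightarrow>
       (\<forall>u\<in>U. f differentiable (at u)) \<and> (\<forall>v. Ck_on k U (\<lambda>u. dir_deriv f u v))"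

definition smooth_on :: "'a::euclidean_space set \<Rightarrow> ('a \<Rightarrow> 'b::real_normed_vector) \<Rightarrow> bool"
  where "smooth_on U f \<longleftrightarrow> (\<forall>k. Ck_on k U f)"


subsection \<open>Smooth manifolds\<close>

text \<open>
  A chart is a pair of its domain and its coordinate map.  Manifolds need not be connected.
\<close>

type_synonym ('p, 'n) chart = "'p set \<times> ('p \<Rightarrow> real^'n)"

definition chart_image :: "('p, 'n::finite) chart \<Rightarrow> (real^'n) set"
  where "chart_image c = snd c ` fst c"

definition chart_inv :: "('p, 'n::finite) chart \<Rightarrow> real^'n \<Rightarrow> 'p"
  where "chart_inv c = inv_into (fst c) (snd c)"

definition transition ::
  "('p, 'n::finite) chart \<Rightarrow> ('p, 'n) chart \<Rightarrow> real^'n \<Rightarrow> real^'n"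
  where "transition c d = snd d \<circ> chart_inv c"

definition smooth_manifold :: "'p topology \<Rightarrow> ('p, 'n::finite) chart set \<Rightarrow> bool"
  where "smooth_manifold M \<A> \<longleftrightarrow>
    Hausdorff_space M \<and>
    (\<exists>\<B>. countable \<B> \<and> (\<forall>B\<in>\<B>. openin M B) \<and>
         (\<forall>U p. openin M U \<and> p \<in> U \<longrightarrow> (\<exists>B\<in>\<B>. p \<in> B \<and> B \<subseteq> U))) \<and>
    (\<Union>c\<in>\<A>. fst c) = topspace M \<and>
    (\<forall>c\<in>\<A>. openin M (fst c) \<and> open (chart_image c) \<and>
       homeomorphic_map (subtopology M (fst c)) (top_of_set (chart_image c)) (snd c)) \<and>
    (\<forall>c\<in>\<A>. \<forall>d\<in>\<A>. smooth_on (snd c ` (fst c \<inter> fst d)) (transition c d))"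

definition smooth_map_on ::
  "('p, 'n::finite) chart set \<Rightarrow> 'p set \<Rightarrow> ('p \<Rightarrow> 'b::real_normed_vector) \<Rightarrow> bool"
  where "smooth_map_on \<A> W f \<longleftrightarrow>
    (\<forall>c\<in>\<A>. smooth_on (snd c ` (fst c \<inter> W)) (f \<circ> chart_inv c))"


subsection \<open>Tensors on a manifold\<close>

text \<open>
  A tangent vector at \<open>p\<close> is given, in a chart \<open>c\<close> around \<open>p\<close>, by its coordinate vector in
  \<open>real^'n\<close>; covariant tensor fields are families of coordinate representations, indexed by
  chart, which agree under the tangent maps of the transition maps.
\<close>

definition one_form ::
  "('p, 'n::finite) chart set \<Rightarrow> (('p, 'n) chart \<Rightarrow> real^'n \<Rightarrow> real^'n \<Rightarrow> real) \<Rightarrow> bool"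
  where "one_form \<A> \<eta> \<longleftrightarrow>
    (\<forall>c\<in>\<A>. \<forall>u\<in>chart_image c. linear (\<eta> c u)) \<and>
    (\<forall>c\<in>\<A>. \<forall>v. smooth_on (chart_image c) (\<lambda>u. \<eta> c u v)) \<and>
    (\<forall>c\<in>\<A>. \<forall>d\<in>\<A>. \<forall>u\<in>snd c ` (fst c \<inter> fst d). \<forall>v.
       \<eta> c u v = \<eta> d (transition c d u) (dir_deriv (transition c d) u v))"

definition riemannian_metric ::
  "('p, 'n::finite) chart set \<Rightarrow>
   (('p, 'n) chart \<Rightarrow> real^'n \<Rightarrow> real^'n \<Rightarrow> real^'n \<Rightarrow> real) \<Rightarrow> bool"
  where "riemannian_metric \<A> g \<longleftrightarrow>
    (\<forall>c\<in>\<A>. \<forall>u\<in>chart_image c. bilinear (g c u) \<and>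
       (\<forall>v w. g c u v w = g c u w v) \<and> (\<forall>v. v \<noteq> 0 \<longrightarrow> g c u v v > 0)) \<and>
    (\<forall>c\<in>\<A>. \<forall>v w. smooth_on (chart_image c) (\<lambda>u. g c u v w)) \<and>
    (\<forall>c\<in>\<A>. \<forall>d\<in>\<A>. \<forall>u\<in>snd c ` (fst c \<inter> fst d). \<forall>v w.
       g c u v w =
         g d (transition c d u) (dir_deriv (transition c d) u v) (dir_deriv (transition c d) u w))"


subsection \<open>Levi-Civita connection, curvature and Laplacian in a chart\<close>

text \<open>
  Throughout, \<open>G\<close> is the coordinate representation of the metric in one chart, and vector
  fields on the chart domain are represented by maps \<open>real^'n \<Rightarrow> real^'n\<close>.
\<close>

definition partial :: "'n::finite \<Rightarrow> (real^'n \<Rightarrow> real) \<Rightarrow> real^'n \<Rightarrow> real"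
  where "partial i h u = dir_deriv h u (axis i 1)"

definition metric_matrix :: "(real^'n \<Rightarrow> real^'n \<Rightarrow> real^'n \<Rightarrow> real) \<Rightarrow> real^'n \<Rightarrow> real^'n^'n::finite"
  where "metric_matrix G u = (\<chi> i j. G u (axis i 1) (axis j 1))"

definition metric_inv :: "(real^'n \<Rightarrow> real^'n \<Rightarrow> real^'n \<Rightarrow> real) \<Rightarrow> real^'n \<Rightarrow> real^'n^'n::finite"
  where "metric_inv G u = matrix_inv (metric_matrix G u)"

text \<open>\<open>christoffel G k i j\<close> is the Christoffel symbol with upper index \<open>k\<close>.\<close>

definition christoffel ::
  "(real^'n \<Rightarrow> real^'n \<Rightarrow> real^'n \<Rightarrow> real) \<Rightarrow> 'n::finite \<Rightarrow> 'n \<Rightarrow> 'n \<Rightarrow> real^'n \<Rightarrow> real"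
  where "christoffel G k i j u =
    (\<Sum>l\<in>UNIV. metric_inv G u $ k $ l *
       (partial i (\<lambda>u. metric_matrix G u $ j $ l) u
        + partial j (\<lambda>u. metric_matrix G u $ i $ l) u
        - partial l (\<lambda>u. metric_matrix G u $ i $ j) u)) / 2"

definition levi_civita ::
  "(real^'n \<Rightarrow> real^'n \<Rightarrow> real^'n \<Rightarrow> real) \<Rightarrow>
   (real^'n \<Rightarrow> real^'n) \<Rightarrow> (real^'n \<Rightarrow> real^'n) \<Rightarrow> real^'n \<Rightarrow> real^'n::finite"
  where "levi_civita G X Y u =
    dir_deriv Y u (X u) +
    (\<chi> k. \<Sum>i\<in>UNIV. \<Sum>j\<in>UNIV. christoffel G k i j u * X u $ i * Y u $ j)"

definition lie_bracket ::
  "(real^'n \<Rightarrow> real^'n) \<Rightarrow> (real^'n \<Rightarrow> real^'n) \<Rightarrow> real^'n \<Rightarrow> real^'n::finite"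
  where "lie_bracket X Y u = dir_deriv Y u (X u) - dir_deriv X u (Y u)"

definition curvature ::
  "(real^'n \<Rightarrow> real^'n \<Rightarrow> real^'n \<Rightarrow> real) \<Rightarrow>
   (real^'n \<Rightarrow> real^'n) \<Rightarrow> (real^'n \<Rightarrow> real^'n) \<Rightarrow> (real^'n \<Rightarrow> real^'n) \<Rightarrow>
   real^'n \<Rightarrow> real^'n::finite"
  where "curvature G X Y Z u =
    levi_civita G X (levi_civita G Y Z) u
    - levi_civita G Y (levi_civita G X Z) u
    - levi_civita G (lie_bracket X Y) Z u"

text \<open>\<open>cov_curvature G X Y Z W\<close> is \<open>(\<nabla>\<^sub>X R)(Y, Z)W\<close>.\<close>

definition cov_curvature ::
  "(real^'n \<Rightarrow> real^'n \<Rightarrow> real^'n \<Rightarrow> real) \<Rightarrow>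
   (real^'n \<Rightarrow> real^'n) \<Rightarrow> (real^'n \<Rightarrow> real^'n) \<Rightarrow> (real^'n \<Rightarrow> real^'n) \<Rightarrow>
   (real^'n \<Rightarrow> real^'n) \<Rightarrow> real^'n \<Rightarrow> real^'n::finite"
  where "cov_curvature G X Y Z W u =
    levi_civita G X (curvature G Y Z W) u
    - curvature G (levi_civita G X Y) Z W u
    - curvature G Y (levi_civita G X Z) W u
    - curvature G Y Z (levi_civita G X W) u"

definition recurrent_curvature ::
  "('p, 'n::finite) chart set \<Rightarrow>
   (('p, 'n) chart \<Rightarrow> real^'n \<Rightarrow> real^'n \<Rightarrow> real^'n \<Rightarrow> real) \<Rightarrow> bool"
  where "recurrent_curvature \<A> g \<longleftrightarrow>
    (\<exists>\<eta>. one_form \<A> \<eta> \<and>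
      (\<forall>c\<in>\<A>. \<forall>X Y Z W.
         smooth_on (chart_image c) X \<and> smooth_on (chart_image c) Y \<and>
         smooth_on (chart_image c) Z \<and> smooth_on (chart_image c) W \<longrightarrow>
         (\<forall>u\<in>chart_image c.
            cov_curvature (g c) X Y Z W u = \<eta> c u (X u) *\<^sub>R curvature (g c) Y Z W u)))"

text \<open>
  The sign convention is \<open>\<Delta> = - trace \<nabla>\<^sup>2\<close>; on vector-valued functions the Laplacian
  acts componentwise.
\<close>

definition laplacian ::
  "(real^'n \<Rightarrow> real^'n \<Rightarrow> real^'n \<Rightarrow> real) \<Rightarrow> (real^'n \<Rightarrow> real) \<Rightarrow> real^'n::finite \<Rightarrow> real"
  where "laplacian G h u =
    - (\<Sum>i\<in>UNIV. \<Sum>j\<in>UNIV. metric_inv G u $ i $ j *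
         (partial i (partial j h) u - (\<Sum>k\<in>UNIV. christoffel G k i j u * partial k h u)))"

definition laplacian_vec ::
  "(real^'n \<Rightarrow> real^'n \<Rightarrow> real^'n \<Rightarrow> real) \<Rightarrow> (real^'n \<Rightarrow> real^'m) \<Rightarrow> real^'n::finite \<Rightarrow> real^'m::finite"
  where "laplacian_vec G F u = (\<chi> a. laplacian G (\<lambda>u. F u $ a) u)"


subsection \<open>Hypersurfaces of Euclidean space\<close>

definition isometric_immersion ::
  "('p, 'n::finite) chart set \<Rightarrow>
   (('p, 'n) chart \<Rightarrow> real^'n \<Rightarrow> real^'n \<Rightarrow> real^'n \<Rightarrow> real) \<Rightarrow> ('p \<Rightarrow> real^'m::finite) \<Rightarrow> bool"
  where "isometric_immersion \<A> g x \<longleftrightarrow>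
    smooth_map_on \<A> UNIV x \<and>
    (\<forall>c\<in>\<A>. \<forall>u\<in>chart_image c.
       inj (dir_deriv (x \<circ> chart_inv c) u) \<and>
       (\<forall>v w. g c u v w =
          dir_deriv (x \<circ> chart_inv c) u v \<bullet> dir_deriv (x \<circ> chart_inv c) u w))"

definition local_unit_normal ::
  "'p topology \<Rightarrow> ('p, 'n::finite) chart set \<Rightarrow> ('p \<Rightarrow> real^'m::finite) \<Rightarrow>
   'p set \<Rightarrow> ('p \<Rightarrow> real^'m) \<Rightarrow> bool"
  where "local_unit_normal M \<A> x W N \<longleftrightarrow>
    openin M W \<and> smooth_map_on \<A> W N \<and> (\<forall>p\<in>W. norm (N p) = 1) \<and>
    (\<forall>c\<in>\<A>. \<forall>u\<in>snd c ` (fst c \<inter> W). \<forall>v.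
       N (chart_inv c u) \<bullet> dir_deriv (x \<circ> chart_inv c) u v = 0)"

text \<open>
  Weingarten formula: \<open>dN(X) = - dx(A X)\<close>.  As \<open>dx\<close> is injective and \<open>dN(X)\<close> is tangent,
  this determines \<open>A X\<close>.
\<close>

definition shape_operator ::
  "('p, 'n::finite) chart \<Rightarrow> ('p \<Rightarrow> real^'m::finite) \<Rightarrow> ('p \<Rightarrow> real^'m) \<Rightarrow>
   real^'n \<Rightarrow> real^'n \<Rightarrow> real^'n"
  where "shape_operator c x N u v =
    inv (dir_deriv (x \<circ> chart_inv c) u) (- dir_deriv (N \<circ> chart_inv c) u v)"

definition mean_curvature ::
  "('p, 'n::finite) chart \<Rightarrow> ('p \<Rightarrow> real^'m::finite) \<Rightarrow> ('p \<Rightarrow> real^'m) \<Rightarrow> real^'n \<Rightarrow> real"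
  where "mean_curvature c x N u = trace (matrix (shape_operator c x N u)) / real CARD('n)"

definition mean_curvature_vector ::
  "('p, 'n::finite) chart \<Rightarrow> ('p \<Rightarrow> real^'m::finite) \<Rightarrow> ('p \<Rightarrow> real^'m) \<Rightarrow> real^'n \<Rightarrow> real^'m"
  where "mean_curvature_vector c x N u = mean_curvature c x N u *\<^sub>R N (chart_inv c u)"

text \<open>
  Around every point there is a local unit normal field, unique up to sign on connected sets,
  and \<open>H N\<close> does not change under \<open>N \<mapsto> - N\<close>.
\<close>

definition biharmonic_hypersurface ::
  "'p topology \<Rightarrow> ('p, 'n::finite) chart set \<Rightarrow>
   (('p, 'n) chart \<Rightarrow> real^'n \<Rightarrow> real^'n \<Rightarrow> real^'n \<Rightarrow> real) \<Rightarrow> ('p \<Rightarrow> real^'m::finite) \<Rightarrow> bool"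
  where "biharmonic_hypersurface M \<A> g x \<longleftrightarrow>
    (\<forall>W N. local_unit_normal M \<A> x W N \<longrightarrow>
      (\<forall>c\<in>\<A>. \<forall>u\<in>snd c ` (fst c \<inter> W).
         laplacian_vec (g c) (mean_curvature_vector c x N) u = 0))"

definition minimal_hypersurface ::
  "'p topology \<Rightarrow> ('p, 'n::finite) chart set \<Rightarrow> ('p \<Rightarrow> real^'m::finite) \<Rightarrow> bool"
  where "minimal_hypersurface M \<A> x \<longleftrightarrow>
    (\<forall>W N. local_unit_normal M \<A> x W N \<longrightarrow>
      (\<forall>c\<in>\<A>. \<forall>u\<in>snd c ` (fst c \<inter> W). mean_curvature c x N u = 0))"

end

theory Submission
  imports Defs
begin

text \<open>
  Everything is local, so fix a chart and a unit normal field \<open>\<nu>\<close>, write \<open>F\<close> for the immersion in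
  coordinates, and let \<open>\<lambda> = - (trace A) / 2 = - n H / 2\<close>.  Splitting \<open>\<Delta>(H \<nu>) = 0\<close> into its tangent and
  normal parts gives \<open>A (grad \<lambda>) = \<lambda> grad \<lambda>\<close> and \<open>trace (Hess \<lambda>) = \<lambda> |A|\<^sup>2\<close>.  If \<open>\<lambda>\<close> is constant near a point,
  the second equation forces \<open>\<lambda> = 0\<close> or \<open>A = 0\<close>, hence \<open>\<lambda> = 0\<close>.  So it is enough to exclude points at which
  \<open>\<lambda>\<close> and \<open>X = grad \<lambda>\<close> are both nonzero.

  By the Gauss equation the curvature is half the Kulkarni-Nomizu square of the second fundamental form \<open>h\<close>, so
  recurrence says that \<open>(\<nabla>\<^sub>v h - \<eta>(v) h / 2)\<close> has vanishing Kulkarni-Nomizu product with \<open>h\<close>.  As \<open>X\<close> is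
  an eigenvector of \<open>A\<close> for a nonzero eigenvalue, this is a strong pointwise condition: either
  \<open>\<nabla>\<^sub>v h = \<eta>(v) h / 2\<close> for all \<open>v\<close>, which the Codazzi equation shows to be impossible, or \<open>h\<close> has rank one on
  the orthogonal complement of \<open>X\<close>.  Since \<open>trace A = - 2 \<lambda>\<close>, the eigenvalues of \<open>A\<close> are then
  \<open>\<lambda>, - 3 \<lambda>, 0, \<dots>, 0\<close>, and recurrence moreover forces the kernel of \<open>A\<close> into the kernel of \<open>\<nabla>\<^sub>X h\<close>.
  Differentiating \<open>A X = \<lambda> X\<close> now determines the Hessian of \<open>\<lambda>\<close> (lemma \<open>hessian_from_shape\<close>):
  \<open>Hess \<lambda> = \<alpha> d\<lambda> \<otimes> d\<lambda> + \<beta> h\<close>, where \<open>\<alpha>\<close> and \<open>\<beta>\<close> are explicit functions of \<open>\<lambda>\<close> and \<open>\<phi> = |X|\<^sup>2\<close>.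

  Put \<open>\<xi> = dF(X)\<close>, a map into Euclidean space.  The formula for the Hessian becomes
  \<open>d\<xi> = d\<lambda> (\<alpha> \<xi> + \<lambda> \<nu>) - \<beta> d\<nu>\<close>, and the symmetry of the second derivatives of \<open>\<xi>\<close> is an integrability condition
  that yields \<open>\<phi> = 14 \<lambda>\<^sup>4\<close>.  Differentiating this once more along \<open>X\<close> contradicts the formula for the Hessian.

  Orthonormal bases are chosen at single points only, and covariant derivatives are read off from derivatives of the Euclidean-valued maps \<open>F\<close>, \<open>\<nu>\<close> and \<open>\<xi>\<close>.
\<close>

section \<open>Calculus of smooth maps\<close>

lemma frechet_derivative_cong_open:
  assumes "open U" "u \<in> U" "\<And>u. u \<in> U \<Longrightarrow> f u = g u"
  shows "frechet_derivative f (at u) = frechet_derivative g (at u)"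
  unfolding frechet_derivative_def using has_derivative_transform_within_open[OF _ assms(1,2)] assms(3)
  by metis

lemma differentiable_cong_open:
  assumes "open U" "u \<in> U" "\<And>u. u \<in> U \<Longrightarrow> f u = g u" "f differentiable (at u)"
  shows "g differentiable (at u)"
  using assms has_derivative_transform_within_open unfolding differentiable_def by metis

lemma dir_deriv_eqI: "(f has_derivative D) (at u) \<Longrightarrow> dir_deriv f u v = D v"
  using frechet_derivative_at by metis

lemma Ck_on_cong:
  assumes "open U" "\<And>u. u \<in> U \<Longrightarrow> f u = g u" "Ck_on k U f"
  shows "Ck_on k U g"
  using assms(2,3)
proof (induction k arbitrary: f g)
  case 0
  then show ?case using continuous_on_cong by (metis Ck_on.simps(1))
next
  case (Suc k)
  have "g differentiable (at u)" if "u \<in> U" for u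
    using differentiable_cong_open[OF assms(1) that, of f g] Suc.prems that by auto
  moreover have "Ck_on k U (\<lambda>u. dir_deriv g u v)" for v
    by (rule Suc.IH[of "\<lambda>u. dir_deriv f u v"])
      (use frechet_derivative_cong_open[OF assms(1), of _ f g] Suc.prems in auto)
  ultimately show ?case by simp
qed

lemma Ck_on_SucD: "Ck_on (Suc k) U f \<Longrightarrow> Ck_on k U f"
proof (induction k arbitrary: f)
  case 0
  then show ?case
    by (auto intro!: differentiable_imp_continuous_on differentiable_at_imp_differentiable_on)
next
  case (Suc k)
  have "Ck_on k U (\<lambda>u. dir_deriv f u v)" for v
    by (rule Suc.IH) (use Suc.prems Ck_on.simps(2) in blast)
  then show ?case using Suc.prems Ck_on.simps(2) by blast
qed

lemma Ck_on_const: "Ck_on k U (\<lambda>u. c)"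
  by (induction k arbitrary: c) auto

lemma Ck_on_add:
  assumes "open U" "Ck_on k U f" "Ck_on k U g"
  shows "Ck_on k U (\<lambda>u. f u + g u)"
  using assms(2,3)
proof (induction k arbitrary: f g)
  case 0
  then show ?case by (auto intro: continuous_intros)
next
  case (Suc k)
  have "dir_deriv (\<lambda>u. f u + g u) u v = dir_deriv f u v + dir_deriv g u v" if "u \<in> U" for u v
    using Suc.prems that
    by (auto intro!: dir_deriv_eqI[of "\<lambda>u. f u + g u"] derivative_eq_intros simp: frechet_derivative_works)
  then have "Ck_on k U (\<lambda>u. dir_deriv (\<lambda>u. f u + g u) u v)" for v
    by (rule Ck_on_cong[OF assms(1), of "\<lambda>u. dir_deriv f u v + dir_deriv g u v" for v, OF sym])
      (use Suc in auto)
  then show ?case using Suc.prems by (auto intro: differentiable_add)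
qed

lemma (in bounded_linear) Ck_on:
  assumes "open U" "Ck_on k U g"
  shows "Ck_on k U (\<lambda>u. f (g u))"
  using assms(2)
proof (induction k arbitrary: g)
  case 0
  then show ?case by (auto intro: continuous_on)
next
  case (Suc k)
  have D: "((\<lambda>u. f (g u)) has_derivative (\<lambda>v. f (dir_deriv g u v))) (at u)" if "u \<in> U" for u
    using Suc.prems that by (auto intro!: has_derivative simp: frechet_derivative_works)
  have "Ck_on k U (\<lambda>u. dir_deriv (\<lambda>u. f (g u)) u v)" for v
    by (rule Ck_on_cong[OF assms(1) dir_deriv_eqI[OF D, symmetric]]) (use Suc in auto)
  then show ?case using differentiableI[OF D] by simp
qed

lemma (in bounded_bilinear) Ck_on:
  assumes "open U" "Ck_on k U f" "Ck_on k U g"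
  shows "Ck_on k U (\<lambda>u. prod (f u) (g u))"
  using assms(2,3)
proof (induction k arbitrary: f g)
  case 0
  then show ?case by (auto intro: continuous_on)
next
  case (Suc k)
  have D: "((\<lambda>u. prod (f u) (g u)) has_derivative (\<lambda>v. prod (f u) (dir_deriv g u v) + prod (dir_deriv f u v) (g u))) (at u)" if "u \<in> U" for u
    using Suc.prems that by (auto intro!: FDERIV simp: frechet_derivative_works)
  have *: "Ck_on k U f" "Ck_on k U g" using Suc.prems Ck_on_SucD by auto
  have "Ck_on k U (\<lambda>u. dir_deriv (\<lambda>u. prod (f u) (g u)) u v)" for v
    by (rule Ck_on_cong[OF assms(1) dir_deriv_eqI[OF D, symmetric]])
      (use Suc * in \<open>auto intro: Ck_on_add[OF assms(1)]\<close>)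
  then show ?case using differentiableI[OF D] by simp
qed

lemma Ck_on_inverse:
  fixes f :: "'a::euclidean_space \<Rightarrow> real"
  assumes "open U" "Ck_on k U f" "\<And>u. u \<in> U \<Longrightarrow> f u \<noteq> 0"
  shows "Ck_on k U (\<lambda>u. inverse (f u))"
  using assms(2)
proof (induction k)
  case 0
  then show ?case using assms(3) by (auto intro: continuous_intros)
next
  case (Suc k)
  have D: "((\<lambda>u. inverse (f u)) has_derivative (\<lambda>v. (- 1) * (inverse (f u) * (dir_deriv f u v * inverse (f u))))) (at u)" if "u \<in> U" for u
    using Suc.prems that assms(3)
    by (auto intro!: derivative_eq_intros simp: frechet_derivative_works mult.assoc)
  have *: "Ck_on k U (\<lambda>u. inverse (f u))" using Suc Ck_on_SucD by auto
  have "Ck_on k U (\<lambda>u. dir_deriv (\<lambda>u. inverse (f u)) u v)" for v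
    by (rule Ck_on_cong[OF assms(1) dir_deriv_eqI[OF D, symmetric]], assumption,
        intro bounded_bilinear.Ck_on[OF bounded_bilinear_mult assms(1)] Ck_on_const *)
      (use Suc.prems in simp)
  then show ?case using differentiableI[OF D] by simp
qed

named_theorems smooth_intros

lemma smooth_on_cong:
  "open U \<Longrightarrow> smooth_on U f \<Longrightarrow> (\<And>u. u \<in> U \<Longrightarrow> f u = g u) \<Longrightarrow> smooth_on U g"
  unfolding smooth_on_def using Ck_on_cong by metis

lemma smooth_on_const [smooth_intros]: "smooth_on U (\<lambda>u. c)"
  by (simp add: smooth_on_def Ck_on_const)

lemma smooth_on_add [smooth_intros]:
  "open U \<Longrightarrow> smooth_on U f \<Longrightarrow> smooth_on U g \<Longrightarrow> smooth_on U (\<lambda>u. f u + g u)"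
  by (simp add: smooth_on_def Ck_on_add)

lemma (in bounded_linear) smooth_on:
  "open U \<Longrightarrow> smooth_on U g \<Longrightarrow> smooth_on U (\<lambda>u. f (g u))"
  by (simp add: smooth_on_def Ck_on)

lemma (in bounded_bilinear) smooth_on:
  "open U \<Longrightarrow> smooth_on U f \<Longrightarrow> smooth_on U g \<Longrightarrow> smooth_on U (\<lambda>u. prod (f u) (g u))"
  by (simp add: smooth_on_def Ck_on)

lemmas smooth_on_mult [smooth_intros] = bounded_bilinear.smooth_on[OF bounded_bilinear_mult]
lemmas smooth_on_scaleR [smooth_intros] = bounded_bilinear.smooth_on[OF bounded_bilinear_scaleR]
lemmas smooth_on_inner [smooth_intros] = bounded_bilinear.smooth_on[OF bounded_bilinear_inner]
lemmas smooth_on_vec_nth = bounded_linear.smooth_on[OF bounded_linear_vec_nth]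
lemmas smooth_on_minus [smooth_intros] = bounded_linear.smooth_on[OF bounded_linear_minus[OF bounded_linear_ident]]

lemma smooth_on_diff [smooth_intros]:
  "open U \<Longrightarrow> smooth_on U f \<Longrightarrow> smooth_on U g \<Longrightarrow> smooth_on U (\<lambda>u. f u - g u)"
  using smooth_on_add[of U f "\<lambda>u. - g u"] smooth_on_minus[of U g] by simp

lemma smooth_on_inverse [smooth_intros]:
  fixes f :: "'a::euclidean_space \<Rightarrow> real"
  shows "open U \<Longrightarrow> smooth_on U f \<Longrightarrow> (\<And>u. u \<in> U \<Longrightarrow> f u \<noteq> 0) \<Longrightarrow> smooth_on U (\<lambda>u. inverse (f u))"
  by (simp add: smooth_on_def Ck_on_inverse)

lemma smooth_on_divide [smooth_intros]:
  fixes f :: "'a::euclidean_space \<Rightarrow> real"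
  shows "open U \<Longrightarrow> smooth_on U f \<Longrightarrow> smooth_on U g \<Longrightarrow> (\<And>u. u \<in> U \<Longrightarrow> g u \<noteq> 0) \<Longrightarrow> smooth_on U (\<lambda>u. f u / g u)"
  unfolding divide_inverse by (intro smooth_intros)

lemma smooth_on_power [smooth_intros]:
  fixes f :: "'a::euclidean_space \<Rightarrow> real"
  shows "open U \<Longrightarrow> smooth_on U f \<Longrightarrow> smooth_on U (\<lambda>u. f u ^ k)"
  by (induction k) (simp_all add: smooth_intros)

lemma smooth_on_sum [smooth_intros]:
  assumes "open U" "\<And>i. i \<in> I \<Longrightarrow> smooth_on U (f i)"
  shows "smooth_on U (\<lambda>u. \<Sum>i\<in>I. f i u)"
  using assms by (induction I rule: infinite_finite_induct) (simp_all add: smooth_intros)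

lemma smooth_on_prod [smooth_intros]:
  fixes f :: "'i \<Rightarrow> 'a::euclidean_space \<Rightarrow> real"
  assumes "open U" "\<And>i. i \<in> I \<Longrightarrow> smooth_on U (f i)"
  shows "smooth_on U (\<lambda>u. \<Prod>i\<in>I. f i u)"
  using assms by (induction I rule: infinite_finite_induct) (simp_all add: smooth_intros)

lemma smooth_on_vec [smooth_intros]:
  assumes "open U" "\<And>i. smooth_on U (f i)"
  shows "smooth_on U (\<lambda>u. (\<chi> i. f i u) :: real^'n::finite)"
proof -
  have "(\<chi> i. f i u) = (\<Sum>i\<in>UNIV. f i u *\<^sub>R axis i 1)" for u
    by (simp add: vec_eq_iff axis_def if_distrib cong: if_cong)
  then show ?thesis using assms by (auto intro!: smooth_intros)
qed

lemma smooth_on_dir_deriv [smooth_intros]: "smooth_on U f \<Longrightarrow> smooth_on U (\<lambda>u. dir_deriv f u v)"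
  unfolding smooth_on_def using Ck_on.simps(2) by blast

lemma smooth_on_subset:
  assumes "smooth_on U f" "V \<subseteq> U" shows "smooth_on V f"
proof -
  have "Ck_on k U f \<Longrightarrow> Ck_on k V f" for k
    using assms(2) by (induction k arbitrary: f) (auto intro: continuous_on_subset)
  then show ?thesis using assms by (auto simp: smooth_on_def)
qed

lemma smooth_on_imp_differentiable: "smooth_on U f \<Longrightarrow> u \<in> U \<Longrightarrow> f differentiable (at u)"
  unfolding smooth_on_def by (metis Ck_on.simps(2))

lemma smooth_on_has_derivative:
  "smooth_on U f \<Longrightarrow> u \<in> U \<Longrightarrow> (f has_derivative frechet_derivative f (at u)) (at u)"
  using smooth_on_imp_differentiable frechet_derivative_works by blast

lemma smooth_on_imp_continuous_on: "smooth_on U f \<Longrightarrow> continuous_on U f"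
  unfolding smooth_on_def by (metis Ck_on.simps(1))

lemma dir_deriv_add [simp]: "f differentiable (at u) \<Longrightarrow> dir_deriv f u (v + w) = dir_deriv f u v + dir_deriv f u w"
  by (rule linear_add[OF linear_frechet_derivative])
lemma dir_deriv_diff [simp]: "f differentiable (at u) \<Longrightarrow> dir_deriv f u (v - w) = dir_deriv f u v - dir_deriv f u w"
  by (rule linear_diff[OF linear_frechet_derivative])
lemma dir_deriv_scaleR [simp]: "f differentiable (at u) \<Longrightarrow> dir_deriv f u (c *\<^sub>R v) = c *\<^sub>R dir_deriv f u v"
  by (rule linear_cmul[OF linear_frechet_derivative])

lemma dir_deriv_basis:
  assumes "f differentiable (at u)"
  shows "dir_deriv f u v = (\<Sum>i\<in>UNIV. v $ i *\<^sub>R dir_deriv f u (axis i 1))"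
proof -
  have l: "linear (frechet_derivative f (at u))" by (rule linear_frechet_derivative[OF assms])
  have "v = (\<Sum>i\<in>UNIV. v $ i *\<^sub>R axis i 1)"
    by (simp add: vec_eq_iff axis_def if_distrib cong: if_cong)
  then have "dir_deriv f u v = dir_deriv f u (\<Sum>i\<in>UNIV. v $ i *\<^sub>R axis i 1)" by simp
  also have "\<dots> = (\<Sum>i\<in>UNIV. v $ i *\<^sub>R dir_deriv f u (axis i 1))"
    by (simp add: linear_sum[OF l] linear_cmul[OF l])
  finally show ?thesis .
qed

lemma smooth_on_dir_deriv_field [smooth_intros]:
  assumes "open U" "smooth_on U f" "smooth_on U Y"
  shows "smooth_on U (\<lambda>u. dir_deriv f u (Y u :: real^'n::finite))"
proof (rule smooth_on_cong[OF assms(1)])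
  show "smooth_on U (\<lambda>u. \<Sum>i\<in>UNIV. Y u $ i *\<^sub>R dir_deriv f u (axis i 1))"
    using assms by (intro smooth_intros smooth_on_vec_nth)
qed (rule dir_deriv_basis[OF smooth_on_imp_differentiable[OF assms(2)], symmetric])

abbreviation dir_deriv2 ::
  "('a::real_normed_vector \<Rightarrow> 'b::real_normed_vector) \<Rightarrow> 'a \<Rightarrow> 'a \<Rightarrow> 'a \<Rightarrow> 'b"
  where "dir_deriv2 f u v w \<equiv> dir_deriv (\<lambda>u. dir_deriv f u w) u v"

text \<open>
  A first derivative taken along a varying vector field splits into a second derivative of \<open>f\<close> and a
  derivative of the field.  All covariant derivatives below are computed by this rule.
\<close>

lemma dir_deriv_along_field:
  fixes f :: "real^'n::finite \<Rightarrow> 'b::real_normed_vector"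
  assumes "open U" "smooth_on U f" "u \<in> U" "Y differentiable (at u)"
  shows "dir_deriv (\<lambda>u. dir_deriv f u (Y u)) u v = dir_deriv2 f u v (Y u) + dir_deriv f u (dir_deriv Y u v)"
    and "(\<lambda>u. dir_deriv f u (Y u)) differentiable (at u)"
proof -
  let ?d = "\<lambda>i u. dir_deriv f u (axis i 1)"
  have bas: "dir_deriv f u w = (\<Sum>i\<in>UNIV. w $ i *\<^sub>R ?d i u)" if "u \<in> U" for u w
    by (rule dir_deriv_basis[OF smooth_on_imp_differentiable[OF assms(2) that]])
  have Y: "(Y has_derivative frechet_derivative Y (at u)) (at u)"
    using assms frechet_derivative_works by blast
  have d: "(?d i has_derivative frechet_derivative (?d i) (at u)) (at u)" for i
    by (rule smooth_on_has_derivative[OF smooth_on_dir_deriv[OF assms(2)] assms(3)])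
  have D: "((\<lambda>u. \<Sum>i\<in>UNIV. Y u $ i *\<^sub>R ?d i u) has_derivative
      (\<lambda>v. \<Sum>i\<in>UNIV. Y u $ i *\<^sub>R dir_deriv (?d i) u v + dir_deriv Y u v $ i *\<^sub>R ?d i u)) (at u)"
    by (intro has_derivative_sum has_derivative_scaleR d bounded_linear.has_derivative[OF bounded_linear_vec_nth Y])
  have D': "((\<lambda>u. dir_deriv f u (Y u)) has_derivative
      (\<lambda>v. \<Sum>i\<in>UNIV. Y u $ i *\<^sub>R dir_deriv (?d i) u v + dir_deriv Y u v $ i *\<^sub>R ?d i u)) (at u)"
    by (rule has_derivative_transform_within_open[OF D assms(1,3)]) (rule bas[symmetric])
  have D2: "((\<lambda>u. \<Sum>i\<in>UNIV. w $ i *\<^sub>R ?d i u) has_derivative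
      (\<lambda>v. \<Sum>i\<in>UNIV. w $ i *\<^sub>R dir_deriv (?d i) u v)) (at u)" for w :: "real^'n"
    by (intro has_derivative_sum has_derivative_scaleR_right d)
  have "((\<lambda>u. dir_deriv f u (Y u)) has_derivative
      (\<lambda>v. dir_deriv2 f u v (Y u) + dir_deriv f u (dir_deriv Y u v))) (at u)"
  proof -
    have e: "dir_deriv2 f u v w = (\<Sum>i\<in>UNIV. w $ i *\<^sub>R dir_deriv (?d i) u v)" for v w
      by (intro dir_deriv_eqI has_derivative_transform_within_open[OF D2 assms(1,3)]) (rule bas[symmetric])
    have "(\<Sum>i\<in>UNIV. Y u $ i *\<^sub>R dir_deriv (?d i) u v + dir_deriv Y u v $ i *\<^sub>R ?d i u) =
        dir_deriv2 f u v (Y u) + dir_deriv f u (dir_deriv Y u v)" for v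
      unfolding sum.distrib by (intro arg_cong2[of _ _ _ _ "(+)"] e[symmetric] bas[OF assms(3), symmetric])
    then show ?thesis using D' by (simp only:)
  qed
  then show "dir_deriv (\<lambda>u. dir_deriv f u (Y u)) u v = dir_deriv2 f u v (Y u) + dir_deriv f u (dir_deriv Y u v)"
    "(\<lambda>u. dir_deriv f u (Y u)) differentiable (at u)"
    by (auto intro: dir_deriv_eqI differentiableI)
qed

lemma dir_deriv2_linear:
  fixes f :: "real^'n::finite \<Rightarrow> 'b::real_normed_vector"
  assumes "open U" "smooth_on U f" "u \<in> U"
  shows "dir_deriv2 f u v (w + w') = dir_deriv2 f u v w + dir_deriv2 f u v w'"
    and "dir_deriv2 f u v (c *\<^sub>R w) = c *\<^sub>R dir_deriv2 f u v w"
proof -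
  have D: "((\<lambda>u. dir_deriv f u w) has_derivative frechet_derivative (\<lambda>u. dir_deriv f u w) (at u)) (at u)" for w
    by (rule smooth_on_has_derivative[OF smooth_on_dir_deriv[OF assms(2)] assms(3)])
  have "dir_deriv2 f u v (w + w') = dir_deriv (\<lambda>u. dir_deriv f u w + dir_deriv f u w') u v"
    using assms by (subst frechet_derivative_cong_open[OF assms(1,3)]) (auto dest: smooth_on_imp_differentiable)
  also have "\<dots> = dir_deriv2 f u v w + dir_deriv2 f u v w'"
    by (rule dir_deriv_eqI) (rule has_derivative_add[OF D D])
  finally show "dir_deriv2 f u v (w + w') = dir_deriv2 f u v w + dir_deriv2 f u v w'" .
  have "dir_deriv2 f u v (c *\<^sub>R w) = dir_deriv (\<lambda>u. c *\<^sub>R dir_deriv f u w) u v"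
    using assms by (subst frechet_derivative_cong_open[OF assms(1,3)]) (auto dest: smooth_on_imp_differentiable)
  also have "\<dots> = c *\<^sub>R dir_deriv2 f u v w"
    by (rule dir_deriv_eqI) (rule has_derivative_scaleR_right[OF D])
  finally show "dir_deriv2 f u v (c *\<^sub>R w) = c *\<^sub>R dir_deriv2 f u v w" .
qed

section \<open>Second derivatives, product rules, and matrix inverses\<close>

lemma mean_value_along:
  fixes f :: "'a::real_normed_vector \<Rightarrow> real"
  assumes "0 < h" "\<And>s. 0 \<le> s \<Longrightarrow> s \<le> h \<Longrightarrow> f differentiable (at (p + s *\<^sub>R v))"
  obtains s where "0 < s" "s < h" "f (p + h *\<^sub>R v) - f p = h * dir_deriv f (p + s *\<^sub>R v) v"
proof -
  have "((\<lambda>s. f (p + s *\<^sub>R v)) has_real_derivative dir_deriv f (p + s *\<^sub>R v) v) (at s)"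
    if "0 \<le> s" "s \<le> h" for s
  proof -
    have f: "(f has_derivative frechet_derivative f (at (p + s *\<^sub>R v))) (at (p + s *\<^sub>R v))"
      using assms(2)[OF that] frechet_derivative_works by blast
    have "((\<lambda>s. p + s *\<^sub>R v) has_derivative (\<lambda>t. t *\<^sub>R v)) (at s)"
      by (auto intro!: derivative_eq_intros)
    from has_derivative_compose[OF this f] show ?thesis
      using assms(2)[OF that] by (auto intro: has_derivative_imp_has_field_derivative)
  qed
  from MVT2[OF assms(1) this] obtain s where "s > 0" "s < h"
    "f (p + h *\<^sub>R v) - f (p + 0 *\<^sub>R v) = (h - 0) * dir_deriv f (p + s *\<^sub>R v) v" by auto
  with that show thesis by simp
qed

text \<open>
  The mean value theorem, applied first along \<open>v\<close> and then along \<open>w\<close>, evaluates the second difference of \<open>f\<close>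
  exactly.  As the left-hand side is symmetric in \<open>v\<close> and \<open>w\<close>, exchanging their roles gives the symmetry of
  second derivatives in the limit \<open>h \<rightarrow> 0\<close>.
\<close>

lemma second_difference:
  fixes f :: "'a::euclidean_space \<Rightarrow> real"
  assumes "smooth_on U f" "0 < h" "h * (norm v + norm w) < r" "ball u r \<subseteq> U"
  obtains p where "dist u p \<le> h * (norm v + norm w)"
    "f (u + h *\<^sub>R v + h *\<^sub>R w) - f (u + h *\<^sub>R v) - f (u + h *\<^sub>R w) + f u = h * h * dir_deriv2 f p w v"
proof -
  have bd: "norm (s *\<^sub>R v + t *\<^sub>R w) \<le> h * (norm v + norm w)" if "0 \<le> s" "s \<le> h" "0 \<le> t" "t \<le> h" for s t
  proof -
    have "norm (s *\<^sub>R v + t *\<^sub>R w) \<le> s * norm v + t * norm w"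
      using norm_triangle_ineq[of "s *\<^sub>R v" "t *\<^sub>R w"] that by simp
    also have "\<dots> \<le> h * norm v + h * norm w" by (intro add_mono mult_right_mono that norm_ge_zero)
    finally show ?thesis by (simp add: algebra_simps)
  qed
  have inU: "u + s *\<^sub>R v + t *\<^sub>R w \<in> U" if "0 \<le> s" "s \<le> h" "0 \<le> t" "t \<le> h" for s t
    using bd[OF that] assms(3,4) by (auto simp: dist_norm subset_eq norm_minus_commute algebra_simps
        dest!: bspec[of _ _ "u + s *\<^sub>R v + t *\<^sub>R w"])
  have d: "f differentiable (at (u + s *\<^sub>R v + t *\<^sub>R w))" if "0 \<le> s" "s \<le> h" "0 \<le> t" "t \<le> h" for s t
    using inU[OF that] assms(1) smooth_on_imp_differentiable by blast
  let ?F = "\<lambda>q. f (q + h *\<^sub>R w) - f q"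
  have F: "(?F has_derivative (\<lambda>x. dir_deriv f (u + s *\<^sub>R v + h *\<^sub>R w) x - dir_deriv f (u + s *\<^sub>R v) x)) (at (u + s *\<^sub>R v))"
    if "0 \<le> s" "s \<le> h" for s
  proof -
    have 1: "(f has_derivative frechet_derivative f (at (u + s *\<^sub>R v + h *\<^sub>R w))) (at (u + s *\<^sub>R v + h *\<^sub>R w))"
      using d[of s h] that assms(2) by (simp add: frechet_derivative_works)
    have 2: "(f has_derivative frechet_derivative f (at (u + s *\<^sub>R v))) (at (u + s *\<^sub>R v))"
      using d[of s 0] that assms(2) by (simp add: frechet_derivative_works)
    have 3: "((\<lambda>q. q + h *\<^sub>R w) has_derivative (\<lambda>x. x)) (at (u + s *\<^sub>R v))"
      by (auto intro!: derivative_eq_intros)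
    show ?thesis by (rule has_derivative_diff[OF has_derivative_compose[OF 3 1] 2])
  qed
  obtain s where s: "0 < s" "s < h" "?F (u + h *\<^sub>R v) - ?F u = h * dir_deriv ?F (u + s *\<^sub>R v) v"
    using mean_value_along[OF assms(2), of ?F u v] F differentiableI by blast
  have Fs: "dir_deriv ?F (u + s *\<^sub>R v) v =
      dir_deriv f (u + s *\<^sub>R v + h *\<^sub>R w) v - dir_deriv f (u + s *\<^sub>R v) v"
    by (rule dir_deriv_eqI) (use F s in auto)
  let ?G = "\<lambda>q. dir_deriv f q v"
  have "?G differentiable (at (u + s *\<^sub>R v + t *\<^sub>R w))" if "0 \<le> t" "t \<le> h" for t
    using inU[of s t] that s smooth_on_imp_differentiable[OF smooth_on_dir_deriv[OF assms(1)]] by simp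
  then obtain t where t: "0 < t" "t < h" "?G (u + s *\<^sub>R v + h *\<^sub>R w) - ?G (u + s *\<^sub>R v) =
      h * dir_deriv ?G (u + s *\<^sub>R v + t *\<^sub>R w) w"
    using mean_value_along[OF assms(2), of ?G "u + s *\<^sub>R v" w] by blast
  show thesis
  proof (rule that)
    show "dist u (u + s *\<^sub>R v + t *\<^sub>R w) \<le> h * (norm v + norm w)"
      using bd[of s t] s t dist_norm[of "u + s *\<^sub>R v + t *\<^sub>R w" u]
      unfolding dist_commute[of u] by (simp add: add.assoc)
    show "f (u + h *\<^sub>R v + h *\<^sub>R w) - f (u + h *\<^sub>R v) - f (u + h *\<^sub>R w) + f u
        = h * h * dir_deriv2 f (u + s *\<^sub>R v + t *\<^sub>R w) w v"
      using s(3) Fs t(3) by (simp add: algebra_simps)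
  qed
qed

lemma dir_deriv2_commute_real:
  fixes f :: "'a::euclidean_space \<Rightarrow> real"
  assumes "open U" "smooth_on U f" "u \<in> U"
  shows "dir_deriv2 f u v w = dir_deriv2 f u w v"
proof (rule ccontr)
  assume neq: "dir_deriv2 f u v w \<noteq> dir_deriv2 f u w v"
  define \<epsilon> where "\<epsilon> = dist (dir_deriv2 f u v w) (dir_deriv2 f u w v) / 2"
  have "\<epsilon> > 0" using neq by (simp add: \<epsilon>_def)
  have cont: "isCont (\<lambda>p. dir_deriv2 f p a b) u" for a b
    using smooth_on_imp_differentiable[OF smooth_on_dir_deriv[OF smooth_on_dir_deriv[OF assms(2)]] assms(3)]
      differentiable_imp_continuous_within by blast
  obtain d1 where d1: "d1 > 0" "\<And>p. dist p u < d1 \<Longrightarrow> dist (dir_deriv2 f p v w) (dir_deriv2 f u v w) < \<epsilon>"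
    using cont[where a=v and b=w] \<open>\<epsilon> > 0\<close> unfolding continuous_at_eps_delta by meson
  obtain d2 where d2: "d2 > 0" "\<And>p. dist p u < d2 \<Longrightarrow> dist (dir_deriv2 f p w v) (dir_deriv2 f u w v) < \<epsilon>"
    using cont[where a=w and b=v] \<open>\<epsilon> > 0\<close> unfolding continuous_at_eps_delta by meson
  obtain r where r: "r > 0" "ball u r \<subseteq> U" using assms openE by blast
  define \<delta> where "\<delta> = min r (min d1 d2)"
  have \<delta>: "\<delta> > 0" using d1 d2 r by (simp add: \<delta>_def)
  define h where "h = \<delta> / (2 * (norm v + norm w + 1))"
  have n: "norm v + norm w + 1 > 0" by (simp add: add_nonneg_pos)
  have h: "h > 0" using \<delta> n by (simp add: h_def)
  have "h * (norm v + norm w) < 2 * h * (norm v + norm w + 1)"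
    using mult_pos_pos[OF h n] h by (simp add: algebra_simps)
  also have "\<dots> = \<delta>" unfolding h_def using n by (subst mult.commute) (simp only: times_divide_eq_right mult.assoc, simp)
  finally have hd: "h * (norm v + norm w) < \<delta>" .
  obtain p where p: "dist u p \<le> h * (norm v + norm w)"
    "f (u + h *\<^sub>R v + h *\<^sub>R w) - f (u + h *\<^sub>R v) - f (u + h *\<^sub>R w) + f u = h * h * dir_deriv2 f p w v"
    using second_difference[OF assms(2) h _ r(2), of v w] hd \<delta>_def by auto
  obtain q where q: "dist u q \<le> h * (norm w + norm v)"
    "f (u + h *\<^sub>R w + h *\<^sub>R v) - f (u + h *\<^sub>R w) - f (u + h *\<^sub>R v) + f u = h * h * dir_deriv2 f q v w"
    using second_difference[OF assms(2) h _ r(2), of w v] hd \<delta>_def by (auto simp: add.commute)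
  have "h * h * dir_deriv2 f p w v = h * h * dir_deriv2 f q v w"
    using p(2) q(2) by (simp add: algebra_simps)
  then have eq: "dir_deriv2 f p w v = dir_deriv2 f q v w" using h by simp
  have "dist p u < d2" "dist q u < d1"
    using p(1) q(1) hd by (auto simp: \<delta>_def dist_commute add.commute)
  then have "dist (dir_deriv2 f p w v) (dir_deriv2 f u w v) < \<epsilon>" "dist (dir_deriv2 f q v w) (dir_deriv2 f u v w) < \<epsilon>"
    using d1 d2 by auto
  then have "dist (dir_deriv2 f u v w) (dir_deriv2 f u w v) < 2 * \<epsilon>"
    unfolding eq dist_real_def by linarith
  then show False by (simp add: \<epsilon>_def)
qed

lemma dir_deriv_inner_const:
  assumes "f differentiable (at u)"
  shows "dir_deriv (\<lambda>u. f u \<bullet> b) u v = dir_deriv f u v \<bullet> b"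
  by (rule dir_deriv_eqI) (use assms in \<open>auto intro!: derivative_eq_intros simp: frechet_derivative_works\<close>)

lemma dir_deriv2_commute:
  fixes f :: "'a::euclidean_space \<Rightarrow> 'b::euclidean_space"
  assumes "open U" "smooth_on U f" "u \<in> U"
  shows "dir_deriv2 f u v w = dir_deriv2 f u w v"
proof (rule euclidean_eqI)
  fix b :: 'b
  have e: "dir_deriv2 f u v w \<bullet> b = dir_deriv2 (\<lambda>u. f u \<bullet> b) u v w" for v w
  proof -
    have "dir_deriv2 (\<lambda>u. f u \<bullet> b) u v w = dir_deriv (\<lambda>u. dir_deriv f u w \<bullet> b) u v"
      by (subst frechet_derivative_cong_open[OF assms(1,3)]) (auto intro: dir_deriv_inner_const smooth_on_imp_differentiable[OF assms(2)])
    also have "\<dots> = dir_deriv2 f u v w \<bullet> b"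
      by (rule dir_deriv_inner_const smooth_on_imp_differentiable[OF smooth_on_dir_deriv] assms)+
    finally show ?thesis by simp
  qed
  show "dir_deriv2 f u v w \<bullet> b = dir_deriv2 f u w v \<bullet> b"
    unfolding e by (rule dir_deriv2_commute_real) (use assms in \<open>auto intro: smooth_intros\<close>)
qed

lemma dir_deriv_scaleR_fun:
  assumes "f differentiable (at u)" "g differentiable (at u)"
  shows "dir_deriv (\<lambda>u. f u *\<^sub>R g u) u v = f u *\<^sub>R dir_deriv g u v + dir_deriv f u v *\<^sub>R g u"
  by (rule dir_deriv_eqI) (use assms in \<open>auto intro!: derivative_eq_intros simp: frechet_derivative_works\<close>)

lemma dir_deriv_mult_fun:
  fixes f g :: "'a::real_normed_vector \<Rightarrow> real"
  assumes "f differentiable (at u)" "g differentiable (at u)"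
  shows "dir_deriv (\<lambda>u. f u * g u) u v = f u * dir_deriv g u v + dir_deriv f u v * g u"
  by (rule dir_deriv_eqI) (use assms in \<open>auto intro!: derivative_eq_intros simp: frechet_derivative_works\<close>)

lemma dir_deriv_inner_fun:
  assumes "f differentiable (at u)" "g differentiable (at u)"
  shows "dir_deriv (\<lambda>u. f u \<bullet> g u) u v = f u \<bullet> dir_deriv g u v + dir_deriv f u v \<bullet> g u"
  by (rule dir_deriv_eqI) (use assms in \<open>auto intro!: derivative_eq_intros simp: frechet_derivative_works\<close>)

lemma dir_deriv_add_fun:
  assumes "f differentiable (at u)" "g differentiable (at u)"
  shows "dir_deriv (\<lambda>u. f u + g u) u v = dir_deriv f u v + dir_deriv g u v"
  by (rule dir_deriv_eqI) (use assms in \<open>auto intro!: derivative_eq_intros simp: frechet_derivative_works\<close>)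

lemma dir_deriv_diff_fun:
  assumes "f differentiable (at u)" "g differentiable (at u)"
  shows "dir_deriv (\<lambda>u. f u - g u) u v = dir_deriv f u v - dir_deriv g u v"
  by (rule dir_deriv_eqI) (use assms in \<open>auto intro!: derivative_eq_intros simp: frechet_derivative_works\<close>)

lemma dir_deriv_minus_fun:
  assumes "f differentiable (at u)"
  shows "dir_deriv (\<lambda>u. - f u) u v = - dir_deriv f u v"
  by (rule dir_deriv_eqI) (use assms in \<open>auto intro!: derivative_eq_intros simp: frechet_derivative_works\<close>)

lemma dir_deriv_vec_nth:
  assumes "f differentiable (at u)"
  shows "dir_deriv (\<lambda>u. f u $ a) u v = dir_deriv f u v $ a"
  by (rule dir_deriv_eqI) (use assms in \<open>auto intro!: bounded_linear.has_derivative[OF bounded_linear_vec_nth] simp: frechet_derivative_works\<close>)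

lemma vec_basis_expansion: "v = (\<Sum>i\<in>UNIV. v $ i *\<^sub>R axis i 1)" for v :: "real^'n::finite"
  by (simp add: vec_eq_iff axis_def if_distrib cong: if_cong)

lemma smooth_on_det:
  assumes "open U" "\<And>i j. smooth_on U (\<lambda>u. A u $ i $ j)"
  shows "smooth_on U (\<lambda>u. det (A u :: real^'n^'n::finite))"
  unfolding det_def using assms by (intro smooth_intros) auto

lemma matrix_inv_mult:
  assumes "invertible (A :: 'a::semiring_1^'n^'m)"
  shows "A ** matrix_inv A = mat 1" "matrix_inv A ** A = mat 1"
  using someI_ex[OF assms[unfolded invertible_def]] by (simp_all add: matrix_inv_def)

text \<open>
  By Cramer's rule the entries of the inverse are quotients of determinants.
\<close>

lemma smooth_on_matrix_inv:
  assumes "open U" "\<And>i j. smooth_on U (\<lambda>u. A u $ i $ j)" "\<And>u. u \<in> U \<Longrightarrow> invertible (A u)"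
  shows "smooth_on U (\<lambda>u. matrix_inv (A u :: real^'n^'n::finite) $ k $ l)"
proof (rule smooth_on_cong[OF assms(1)])
  \<comment> \<open>The matrix of Cramer's rule for the \<open>l\<close>-th column of the inverse: column \<open>k\<close> is replaced by a unit vector.\<close>
  let ?C = "\<lambda>u. (\<chi> i j. if j = k then axis l 1 $ i else A u $ i $ j) :: real^'n^'n"
  have "smooth_on U (\<lambda>u. ?C u $ i $ j)" for i j
    using assms by (cases "j = k") (simp_all add: smooth_on_const)
  then show "smooth_on U (\<lambda>u. det (?C u) / det (A u))"
    using assms(1,3) invertible_det_nz by (intro smooth_on_divide smooth_on_det assms(2)) blast+
  fix u assume u: "u \<in> U"
  then have "A u ** matrix_inv (A u) = mat 1"
    using matrix_inv_mult(1)[OF assms(3)] by blast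
  then have "A u *v (matrix_inv (A u) *v axis l 1) = axis l 1"
    by (simp add: matrix_vector_mul_assoc)
  then have "(matrix_inv (A u) *v axis l 1) $ k = det (?C u) / det (A u)"
    using cramer[of "A u" "matrix_inv (A u) *v axis l 1" "axis l 1"] assms(3)[OF u]
    by (simp add: invertible_det_nz)
  moreover have "(matrix_inv (A u) *v axis l 1) $ k = matrix_inv (A u) $ k $ l"
    by (simp add: matrix_vector_mult_def axis_def if_distrib cong: if_cong)
  ultimately show "det (?C u) / det (A u) = matrix_inv (A u) $ k $ l" by simp
qed

lemma trace_commute:
  fixes f g :: "real^'n::finite \<Rightarrow> real^'n"
  assumes "linear f" "linear g"
  shows "(\<Sum>i\<in>UNIV. f (g (axis i 1)) $ i) = (\<Sum>i\<in>UNIV. g (f (axis i 1)) $ i)"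
proof -
  have "(\<Sum>i\<in>UNIV. f (g (axis i 1)) $ i) = trace (matrix f ** matrix g)" if "linear f" "linear g" for f g :: "real^'n::finite \<Rightarrow> real^'n"
    unfolding matrix_compose[OF that(2,1), symmetric] by (simp only: trace_def matrix_def vec_lambda_beta o_apply)
  note tr = this
  show ?thesis
    unfolding tr[OF assms] tr[OF assms(2,1)] by (rule trace_mul_sym)
qed

section \<open>Pointwise algebra\<close>

lemma sum_Basis_inner: "(\<Sum>b\<in>Basis. (x \<bullet> b) * (y \<bullet> b)) = x \<bullet> (y::'a::euclidean_space)"
  by (simp add: euclidean_inner[symmetric])

text \<open>
  The pointwise heart of the argument.  In an orthonormal basis of one tangent space, \<open>h\<close> is the second fundamental
  form, \<open>\<tau> v\<close> its covariant derivative along \<open>v\<close> (totally symmetric by Codazzi), \<open>X\<close> the gradient of \<open>lam\<close>,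
  and \<open>\<sigma>\<close> the Hessian of \<open>lam\<close>.  The hypothesis \<open>diff_eig\<close> is the derivative of \<open>eig\<close>, and \<open>rec\<close> is
  the recurrence of the curvature.  The second conclusion supplies a direction orthogonal to the gradient on which
  the integrability condition for the Hessian can later be tested.
\<close>

lemma hessian_from_shape:
  fixes X :: "'a::euclidean_space" and h \<sigma> :: "'a \<Rightarrow> 'a \<Rightarrow> real" and \<tau> :: "'a \<Rightarrow> 'a \<Rightarrow> 'a \<Rightarrow> real"
    and lam :: real
  defines "\<phi> \<equiv> X \<bullet> X"
  assumes h: "bilinear h" "\<And>v w. h v w = h w v"
    and \<tau>: "\<And>v. bilinear (\<tau> v)" "\<And>v y w. \<tau> v y w = \<tau> y v w" "\<And>v y w. \<tau> v y w = \<tau> v w y"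
    and \<sigma>: "\<And>v w. \<sigma> v w = \<sigma> w v"
    and S: "\<And>v w. S v \<bullet> w = \<sigma> v w"
    and X: "X \<noteq> 0" and lam: "lam \<noteq> 0"
    and eig: "\<And>w. h X w = lam * (X \<bullet> w)"
    and tr_h: "(\<Sum>b\<in>Basis. h b b) = - 2 * lam"
    and tr_\<tau>: "\<And>v. (\<Sum>b\<in>Basis. \<tau> v b b) = - 2 * (X \<bullet> v)"
    and tr_\<sigma>: "(\<Sum>b\<in>Basis. \<sigma> b b) = lam * (\<Sum>b\<in>Basis. \<Sum>c\<in>Basis. (h b c)\<^sup>2)"
    and diff_eig: "\<And>v w. \<tau> v X w + h (S v) w = (X \<bullet> v) * (X \<bullet> w) + lam * \<sigma> v w"
    and rec: "\<And>v y w z t. (\<tau> v y w - \<eta> v * h y w) * h z t + h y w * (\<tau> v z t - \<eta> v * h z t)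
       - (\<tau> v y t - \<eta> v * h y t) * h z w - h y t * (\<tau> v z w - \<eta> v * h z w) = 0"
  shows "\<sigma> v w = (10 * lam^3 / \<phi> + 1 / (2 * lam)) * ((X \<bullet> v) * (X \<bullet> w)) + \<phi> / (4 * lam\<^sup>2) * h v w"
    and "\<exists>e. X \<bullet> e = 0 \<and> h e e \<noteq> 0"
proof -
  have \<phi>: "\<phi> > 0" using X by (simp add: \<phi>_def)
  note hlin = bilinear_ladd[OF h(1)] bilinear_radd[OF h(1)] bilinear_lmul[OF h(1)] bilinear_rmul[OF h(1)]
    bilinear_lsub[OF h(1)] bilinear_rsub[OF h(1)] bilinear_lzero[OF h(1)] bilinear_rzero[OF h(1)]
  have \<tau>lin: "\<tau> v (a - b) w = \<tau> v a w - \<tau> v b w" "\<tau> v w (a - b) = \<tau> v w a - \<tau> v w b"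
      "\<tau> v (c *\<^sub>R a) w = c * \<tau> v a w" "\<tau> v w (c *\<^sub>R a) = c * \<tau> v w a" for v a b c w
    using bilinear_lsub[OF \<tau>(1)] bilinear_rsub[OF \<tau>(1)] bilinear_lmul[OF \<tau>(1)] bilinear_rmul[OF \<tau>(1)] by auto
  define P where "P v = v - ((X \<bullet> v) / \<phi>) *\<^sub>R X" for v
  have P: "X \<bullet> P v = 0" for v using \<phi> by (simp add: P_def inner_diff_right \<phi>_def)
  have eig': "h w X = lam * (X \<bullet> w)" for w using eig h(2) by metis
  have hP: "h v w = lam / \<phi> * ((X \<bullet> v) * (X \<bullet> w)) + h (P v) (P w)" for v w
    using \<phi> P[of v, unfolded P_def] unfolding P_def hlin eig eig' by (simp add: \<phi>_def[symmetric] field_simps)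
  \<comment> \<open>If \<open>h\<close> had rank at least two on the complement of \<open>X\<close>, recurrence would give \<open>\<tau> v = \<eta> v * h\<close> for all \<open>v\<close>;
    Codazzi for \<open>X\<close> and a vector orthogonal to \<open>X\<close> would then make \<open>h\<close> vanish there.\<close>
  have rank1: "h y w * h z t = h y t * h z w" if perp: "X \<bullet> y = 0" "X \<bullet> w = 0" "X \<bullet> z = 0" "X \<bullet> t = 0" for y w z t
  proof (rule ccontr)
    assume neq: "h y w * h z t \<noteq> h y t * h z w"
    have hX: "h X v = 0" "h v X = 0" if "X \<bullet> v = 0" for v using that eig eig' by auto
    have T0: "\<tau> v a b = \<eta> v * h a b" for v a b
    proof -
      define T where "T a b = \<tau> v a b - \<eta> v * h a b" for a b
      have Tsym: "T a b = T b a" for a b using \<tau>(3) h(2) by (simp add: T_def)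
      have Trec: "T a b * h c d + h a b * T c d - T a d * h c b - h a d * T c b = 0" for a b c d
        using rec[of v a b c d] by (simp add: T_def)
      have hXX: "h X X = lam * \<phi>" using eig by (simp add: \<phi>_def)
      define \<kappa> where "\<kappa> = T X X / (lam * \<phi>)"
      have T1: "T a b = - \<kappa> * h a b" if "X \<bullet> a = 0" "X \<bullet> b = 0" for a b
        using Trec[of X X a b] hX[OF that(1)] hX[OF that(2)] hXX lam \<phi> by (simp add: \<kappa>_def field_simps)
      have "2 * \<kappa> * (h y w * h z t - h y t * h z w) = 0"
        using Trec[of y w z t] unfolding T1[OF perp(1,2)] T1[OF perp(1,4)] T1[OF perp(3,2)] T1[OF perp(3,4)]
        by (auto simp: algebra_simps)
      with neq have "\<kappa> = 0" by simp
      then have TXX: "T X X = 0" and T2: "\<And>a b. X \<bullet> a = 0 \<Longrightarrow> X \<bullet> b = 0 \<Longrightarrow> T a b = 0"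
        using T1 lam \<phi> by (auto simp: \<kappa>_def)
      have T3: "T X a = 0" if "X \<bullet> a = 0" for a
      proof (rule ccontr)
        assume ne: "T X a \<noteq> 0"
        have *: "T X b * h c d = T X d * h c b" if "X \<bullet> b = 0" "X \<bullet> c = 0" "X \<bullet> d = 0" for b c d
          using Trec[of X b c d] hX[OF that(1)] hX[OF that(3)] by simp
        have **: "h c d = T X d * (h c a / T X a)" if "X \<bullet> c = 0" "X \<bullet> d = 0" for c d
          using *[of a c d] ne that \<open>X \<bullet> a = 0\<close> by (simp add: field_simps)
        show False using neq **[of y w] **[of z t] **[of y t] **[of z w] perp by simp
      qed
      have Tlin: "T (a - b) w = T a w - T b w" "T w (a - b) = T w a - T w b"
        "T (c *\<^sub>R a) w = c * T a w" "T w (c *\<^sub>R a) = c * T w a" for a b c w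
        by (simp_all add: T_def \<tau>lin hlin algebra_simps)
      have "T (P a) (P b) = 0" "T X (P b) = 0" "T X (P a) = 0" using T2 T3 P by auto
      then have "T a b = 0" using TXX Tsym[of a X] by (simp add: P_def Tlin)
      then show ?thesis by (simp add: T_def)
    qed
    have \<eta>: "X \<bullet> v = \<eta> v * lam" for v
      using tr_\<tau>[of v] tr_h T0 by (simp add: sum_distrib_left[symmetric])
    have "h a b = 0" if "X \<bullet> a = 0" "X \<bullet> b = 0" for a b
    proof -
      have "\<eta> X * h a b = \<eta> a * h X b" using T0[of X a b] T0[of a X b] \<tau>(2)[of X a b] by simp
      then have "\<eta> X * h a b = 0" using hX that by simp
      moreover have "\<eta> X \<noteq> 0" using \<eta>[of X] \<phi> by (auto simp: \<phi>_def)
      ultimately show ?thesis by simp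
    qed
    with neq perp show False by simp
  qed
  have trP: "(\<Sum>b\<in>Basis. h (P b) (P b)) = - 3 * lam"
  proof -
    have "(\<Sum>b\<in>Basis. h b b) = lam / \<phi> * (\<Sum>b\<in>Basis. (X \<bullet> b) * (X \<bullet> b)) + (\<Sum>b\<in>Basis. h (P b) (P b))"
      unfolding sum_distrib_left sum.distrib[symmetric] by (rule sum.cong[OF refl hP])
    then show ?thesis using tr_h \<phi> unfolding sum_Basis_inner by (simp add: \<phi>_def)
  qed
  obtain z where z: "X \<bullet> z = 0" "h z z \<noteq> 0"
  proof -
    have "\<exists>b\<in>Basis. h (P b) (P b) \<noteq> 0"
    proof (rule ccontr)
      assume "\<not> (\<exists>b\<in>Basis. h (P b) (P b) \<noteq> 0)"
      then have "(\<Sum>b\<in>Basis. h (P b) (P b)) = 0" by simp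
      with trP lam show False by simp
    qed
    then show thesis using that P by blast
  qed
  then show "\<exists>e. X \<bullet> e = 0 \<and> h e e \<noteq> 0" by blast
  define \<theta> where "\<theta> = h z z"
  have \<theta>: "\<theta> \<noteq> 0" using z by (simp add: \<theta>_def)
  \<comment> \<open>The vector representing the linear form \<open>h z\<close>; it spans the image of \<open>h\<close> on the complement of \<open>X\<close>.\<close>
  define e where "e = (\<Sum>b\<in>Basis. h z b *\<^sub>R b)"
  have e: "e \<bullet> w = h z w" for w
  proof -
    have l: "linear (h z)" using h(1) by (simp add: bilinear_def)
    have "h z w = h z (\<Sum>b\<in>Basis. (w \<bullet> b) *\<^sub>R b)" by (simp add: euclidean_representation)
    also have "\<dots> = (\<Sum>b\<in>Basis. (w \<bullet> b) * h z b)" by (simp add: linear_sum[OF l] linear_cmul[OF l])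
    finally show ?thesis by (simp add: e_def inner_sum_left inner_sum_right inner_commute mult.commute)
  qed
  have eX: "e \<bullet> X = 0" "X \<bullet> e = 0" using e eig' z by (simp_all add: inner_commute)
  have h_eq: "h v w = lam / \<phi> * ((X \<bullet> v) * (X \<bullet> w)) + (e \<bullet> v) * (e \<bullet> w) / \<theta>" for v w
  proof -
    have "h (P v) (P w) * \<theta> = h z (P v) * h z (P w)"
      using rank1[of "P v" "P w" z z] P z h(2) by (simp add: \<theta>_def)
    moreover have "h z (P v) = e \<bullet> v" for v
      using e[of "P v"] eX by (simp add: P_def inner_diff_right)
    ultimately show ?thesis unfolding hP[of v w] using \<theta> by (simp add: field_simps)
  qed
  define \<psi> where "\<psi> = e \<bullet> e"
  have \<psi>: "\<psi> = - 3 * lam * \<theta>"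
  proof -
    have "(\<Sum>b\<in>Basis. h b b) = lam / \<phi> * (\<Sum>b\<in>Basis. (X \<bullet> b) * (X \<bullet> b)) + (\<Sum>b\<in>Basis. (e \<bullet> b) * (e \<bullet> b)) / \<theta>"
      unfolding sum_distrib_left sum_divide_distrib sum.distrib[symmetric] by (rule sum.cong[OF refl h_eq])
    then show ?thesis using tr_h \<phi> \<theta> unfolding sum_Basis_inner by (simp add: \<phi>_def[symmetric] \<psi>_def[symmetric] field_simps)
  qed
  have \<psi>0: "\<psi> \<noteq> 0" using \<psi> lam \<theta> by simp

  define T where "T a b = \<tau> X a b - \<eta> X * h a b" for a b
  have Tsym: "T a b = T b a" for a b using \<tau>(3) h(2) by (simp add: T_def)
  have Trec: "T a b * h c d + h a b * T c d - T a d * h c b - h a d * T c b = 0" for a b c d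
    using rec[of X a b c d] by (simp add: T_def)
  have hXe: "h X e = 0" "h e w = \<psi> / \<theta> * (e \<bullet> w)" "h w e = \<psi> / \<theta> * (e \<bullet> w)" for w
    by (simp_all add: h_eq eX \<psi>_def)
  \<comment> \<open>Recurrence along \<open>X\<close>: the form \<open>T\<close>, hence also \<open>\<tau> X\<close>, is built from \<open>X\<close> and \<open>e\<close> only.\<close>
  obtain p q where pq: "\<And>w. T X w = p * (X \<bullet> w) + q * (e \<bullet> w)"
  proof -
    have "T X w = (- lam * T e e / (\<psi>\<^sup>2 / \<theta>)) * (X \<bullet> w) + (T X e * \<psi> / \<theta> / (\<psi>\<^sup>2 / \<theta>)) * (e \<bullet> w)" for w
      using Trec[of X w e e] \<psi>0 \<theta> by (simp add: hXe eX eig \<psi>_def[symmetric] divide_simps power2_eq_square) algebra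
    then show thesis using that by blast
  qed
  obtain a b c where abc: "\<And>v w. \<tau> X v w = a * ((X \<bullet> v) * (X \<bullet> w)) + b * ((X \<bullet> v) * (e \<bullet> w) + (e \<bullet> v) * (X \<bullet> w)) + c * ((e \<bullet> v) * (e \<bullet> w))"
  proof -
    have T: "T v w = ((X \<bullet> v) * T X w + (X \<bullet> w) * T X v) / \<phi> - T X X / (lam * \<phi>) * h v w" for v w
    proof -
      have "(lam * \<phi>) * T v w = lam * ((X \<bullet> v) * T X w + (X \<bullet> w) * T X v) - T X X * h v w"
        using Trec[of X X v w] Tsym[of v X] by (simp add: eig eig' \<phi>_def[symmetric] algebra_simps)
      also have "\<dots> = (lam * \<phi>) * (((X \<bullet> v) * T X w + (X \<bullet> w) * T X v) / \<phi> - T X X / (lam * \<phi>) * h v w)"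
        using lam \<phi> by (simp add: right_diff_distrib)
      finally show ?thesis using lam \<phi> by simp
    qed
    define k where "k = \<eta> X - T X X / (lam * \<phi>)"
    have "\<tau> X v w = ((X \<bullet> v) * T X w + (X \<bullet> w) * T X v) / \<phi> + k * h v w" for v w
      using T[of v w] T_def[of v w] unfolding k_def by (simp only: left_diff_distrib)
    note k = this
    have "\<tau> X v w = (2 * p / \<phi> + k * (lam / \<phi>)) * ((X \<bullet> v) * (X \<bullet> w))
      + (q / \<phi>) * ((X \<bullet> v) * (e \<bullet> w) + (e \<bullet> v) * (X \<bullet> w))
      + (k / \<theta>) * ((e \<bullet> v) * (e \<bullet> w))" for v w
      unfolding k[of v w] pq[of v] pq[of w] h_eq[of v w] by (simp only: ring_distribs add_divide_distrib) (simp add: mult_ac)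
    then show thesis using that by blast
  qed
  \<comment> \<open>The derivative of the eigenvalue equation, evaluated on \<open>X\<close> itself, fixes two of the three coefficients of \<open>\<tau> X\<close>;
    the trace fixes the third.\<close>
  have \<tau>XX: "\<tau> X v X = \<phi> * (X \<bullet> v)" for v
    using diff_eig[of v X] \<tau>(2)[of X v X] S[of v X] by (simp add: eig' \<phi>_def inner_commute)
  have "a = 1" using \<tau>XX[of X] abc[of X X] \<phi> eX by (simp add: \<phi>_def[symmetric])
  have "b = 0" using \<tau>XX[of e] abc[of e X] \<phi> eX \<psi>0 by (simp add: \<phi>_def[symmetric] \<psi>_def[symmetric])
  have \<tau>X: "\<tau> X v w = (X \<bullet> v) * (X \<bullet> w) + c * ((e \<bullet> v) * (e \<bullet> w))" for v w
    using abc[of v w] \<open>a = 1\<close> \<open>b = 0\<close> by simp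
  have c: "\<phi> + c * \<psi> = - 2 * \<phi>"
  proof -
    have "(\<Sum>b\<in>Basis. \<tau> X b b) = (\<Sum>b\<in>Basis. (X \<bullet> b) * (X \<bullet> b)) + c * (\<Sum>b\<in>Basis. (e \<bullet> b) * (e \<bullet> b))"
      unfolding sum_distrib_left sum.distrib[symmetric] by (rule sum.cong[OF refl \<tau>X])
    then show ?thesis using tr_\<tau>[of X] unfolding sum_Basis_inner by (simp add: \<phi>_def[symmetric] \<psi>_def[symmetric])
  qed
  then have c': "c = \<phi> / (lam * \<theta>)" using \<psi> lam \<theta> by (simp add: field_simps)
  have \<sigma>1: "lam * \<sigma> v w = c * ((e \<bullet> v) * (e \<bullet> w)) + lam / \<phi> * (\<sigma> v X * (X \<bullet> w)) + \<sigma> v e * (e \<bullet> w) / \<theta>" for v w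
    using diff_eig[of v w] \<tau>(2)[of v X w] \<tau>X[of v w] h_eq[of "S v" w] S[of v X] S[of v e]
    by (simp add: inner_commute)
  have \<sigma>e: "\<sigma> v e = - 3 * \<phi> * (e \<bullet> v) / (4 * lam)" for v
  proof -
    have "lam * \<sigma> v e = c * \<psi> * (e \<bullet> v) + \<sigma> v e * \<psi> / \<theta>"
      using \<sigma>1[of v e] eX by (simp add: \<psi>_def)
    then have "4 * lam * \<sigma> v e = (c * \<psi>) * (e \<bullet> v)" using \<psi> \<theta> by (simp add: field_simps)
    also have "c * \<psi> = - 3 * \<phi>" using c by simp
    finally show ?thesis using lam by (simp add: field_simps)
  qed
  have \<sigma>X: "\<sigma> v X = \<sigma> X X / \<phi> * (X \<bullet> v)" for v
  proof -
    have "lam * \<sigma> X v = lam * (\<sigma> X X / \<phi> * (X \<bullet> v))"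
      using \<sigma>1[of X v] eX \<sigma>e[of X] by simp
    then have "\<sigma> X v = \<sigma> X X / \<phi> * (X \<bullet> v)" by (rule mult_left_cancel[OF lam, THEN iffD1])
    then show ?thesis using \<sigma>(1)[of v X] by (rule trans[rotated])
  qed
  define s where "s = \<sigma> X X / \<phi>"
  have \<sigma>2: "\<sigma> v w = s / \<phi> * ((X \<bullet> v) * (X \<bullet> w)) + \<phi> / (4 * lam\<^sup>2) * ((e \<bullet> v) * (e \<bullet> w) / \<theta>)" for v w
  proof -
    have "lam * \<sigma> v w = lam * (s / \<phi> * ((X \<bullet> v) * (X \<bullet> w)) + \<phi> / (4 * lam\<^sup>2) * ((e \<bullet> v) * (e \<bullet> w) / \<theta>))"
      unfolding \<sigma>1[of v w] \<sigma>X[of v] \<sigma>e[of v] s_def[symmetric] c'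
      using lam \<theta> \<phi> by (simp add: field_simps power2_eq_square)
    then show ?thesis using lam by simp
  qed
  have tr2: "(\<Sum>b\<in>Basis. \<sigma> b b) = s - 3 * \<phi> / (4 * lam)"
  proof -
    have "(\<Sum>b\<in>Basis. \<sigma> b b) = s / \<phi> * (\<Sum>b\<in>Basis. (X \<bullet> b) * (X \<bullet> b))
        + \<phi> / (4 * lam\<^sup>2) * ((\<Sum>b\<in>Basis. (e \<bullet> b) * (e \<bullet> b)) / \<theta>)"
      unfolding sum_distrib_left sum_divide_distrib sum.distrib[symmetric] by (rule sum.cong[OF refl \<sigma>2])
    then show ?thesis unfolding sum_Basis_inner
      using \<psi> \<theta> \<phi> lam by (simp add: \<phi>_def[symmetric] \<psi>_def[symmetric] power2_eq_square field_simps)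
  qed
  have tr3: "(\<Sum>b\<in>Basis. \<Sum>c\<in>Basis. (h b c)\<^sup>2) = 10 * lam\<^sup>2"
  proof -
    have "(\<Sum>c\<in>Basis. (h b c)\<^sup>2) = lam\<^sup>2 / \<phi> * (X \<bullet> b) * (X \<bullet> b) + \<psi> / \<theta>\<^sup>2 * (e \<bullet> b) * (e \<bullet> b)" for b
    proof -
      have "(\<Sum>c\<in>Basis. (h b c)\<^sup>2) = (\<Sum>c\<in>Basis. (lam / \<phi> * (X \<bullet> b))\<^sup>2 * ((X \<bullet> c) * (X \<bullet> c))
          + 2 * (lam / \<phi> * (X \<bullet> b)) * ((e \<bullet> b) / \<theta>) * ((X \<bullet> c) * (e \<bullet> c)) + ((e \<bullet> b) / \<theta>)\<^sup>2 * ((e \<bullet> c) * (e \<bullet> c)))"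
        by (rule sum.cong[OF refl]) (simp add: h_eq power2_eq_square algebra_simps)
      also have "\<dots> = (lam / \<phi> * (X \<bullet> b))\<^sup>2 * \<phi> + ((e \<bullet> b) / \<theta>)\<^sup>2 * \<psi>"
        unfolding sum.distrib sum_distrib_left[symmetric] sum_Basis_inner eX by (simp add: \<phi>_def \<psi>_def)
      finally show ?thesis using \<phi> by (simp add: power2_eq_square field_simps)
    qed
    then have "(\<Sum>b\<in>Basis. \<Sum>c\<in>Basis. (h b c)\<^sup>2) = lam\<^sup>2 / \<phi> * (\<Sum>b\<in>Basis. (X \<bullet> b) * (X \<bullet> b))
       + \<psi> / \<theta>\<^sup>2 * (\<Sum>b\<in>Basis. (e \<bullet> b) * (e \<bullet> b))"
      by (simp add: sum.distrib sum_distrib_left mult.assoc)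
    then show ?thesis unfolding sum_Basis_inner
      using \<psi> \<theta> \<phi> by (simp add: \<phi>_def[symmetric] \<psi>_def[symmetric] power2_eq_square field_simps)
  qed
  have s: "s = 10 * lam^3 + 3 * \<phi> / (4 * lam)"
    using tr_\<sigma> tr2 tr3 by (simp add: power2_eq_square power3_eq_cube)
  show "\<sigma> v w = (10 * lam^3 / \<phi> + 1 / (2 * lam)) * ((X \<bullet> v) * (X \<bullet> w)) + \<phi> / (4 * lam\<^sup>2) * h v w"
  proof -
    have 1: "(e \<bullet> v) * (e \<bullet> w) / \<theta> = h v w - lam / \<phi> * ((X \<bullet> v) * (X \<bullet> w))" using h_eq[of v w] by simp
    have 2: "s / \<phi> - \<phi> / (4 * lam\<^sup>2) * (lam / \<phi>) = 10 * lam^3 / \<phi> + 1 / (2 * lam)"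
      using \<phi> lam unfolding s by (simp add: field_simps power2_eq_square power3_eq_cube)
    have 3: "A * x + k * (H - l * x) = (A - k * l) * x + k * H" for A x k H l :: real
      by (simp add: algebra_simps)
    show ?thesis unfolding \<sigma>2[of v w] 1 3 2 ..
  qed
qed

text \<open>
  Here \<open>l\<close> stands for \<open>\<lambda>\<close>, \<open>p\<close> for \<open>\<phi> = |grad \<lambda>|\<^sup>2\<close>, \<open>a\<close> and \<open>b\<close> for the two coefficients of the Hessian,
  and \<open>B\<close> for the derivative of \<open>b\<close> along \<open>grad \<lambda>\<close>, which is known in two ways: from \<open>4 b l\<^sup>2 = p\<close>, and from the
  integrability condition.
\<close>

lemma gradient_norm_determined:
  fixes l p a b B :: real
  assumes "l \<noteq> 0" "p > 0" "a = 10 * l^3 / p + 1 / (2 * l)" "b = p / (4 * l\<^sup>2)"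
    "B * (4 * l\<^sup>2) + b * (8 * l * p) = 2 * (a * p\<^sup>2 + b * (l * p))" "B = p * (a * b - l)"
  shows "p = 14 * l^4"
proof -
  have ap: "a * p = 10 * l^3 + p / (2 * l)" and b: "b * (4 * l\<^sup>2) = p"
    using assms(1,2) by (simp_all add: assms(3,4) field_simps)
  have "2 * l * (a * p) = 20 * l^4 + p" unfolding ap using assms(1) by (simp add: field_simps power4_eq_xxxx power3_eq_cube)
  have "p * (p * (14 * l^4 - p)) = 0"
    using assms(1,2,5) b ap \<open>2 * l * (a * p) = 20 * l^4 + p\<close> unfolding assms(6) by algebra
  then show ?thesis using assms(2) by simp
qed

text \<open>
  The last hypothesis is the derivative of \<open>p = 14 * l^4\<close> along the gradient, with the derivative of \<open>p\<close>
  replaced by its value from the Hessian.  It would require \<open>41 = 56\<close>.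
\<close>

lemma gradient_norm_contradiction:
  fixes l p a b :: real
  assumes "l \<noteq> 0" "p > 0" "a = 10 * l^3 / p + 1 / (2 * l)" "b = p / (4 * l\<^sup>2)"
    "p = 14 * l^4" "2 * (a * p\<^sup>2 + b * (l * p)) = 56 * l^3 * p"
  shows False
proof -
  have ap: "a * p = 17 * l^3" and b: "b * 2 = 7 * l\<^sup>2"
    using assms(1,2) by (simp_all add: assms(3,4,5) field_simps power4_eq_xxxx power3_eq_cube power2_eq_square)
  have "p * l^3 = 0" using assms(6) ap b by algebra
  then show False using assms(1,2) by simp
qed

section \<open>Hypersurface patches: Gauss formula and Gauss equation\<close>

text \<open>
  A hypersurface in one chart, with a unit normal field; \<open>G\<close> is kept apart from the induced metric because it agrees
  with it on \<open>U\<close> only.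
\<close>

locale hypersurface_patch =
  fixes U :: "(real^'n::finite) set" and F \<nu> :: "real^'n \<Rightarrow> real^'m::finite"
    and G :: "real^'n \<Rightarrow> real^'n \<Rightarrow> real^'n \<Rightarrow> real"
  assumes openU: "open U"
    and smooth_F: "smooth_on U F" and smooth_\<nu>: "smooth_on U \<nu>"
    and \<nu>_unit: "u \<in> U \<Longrightarrow> \<nu> u \<bullet> \<nu> u = 1"
    and \<nu>_normal: "u \<in> U \<Longrightarrow> \<nu> u \<bullet> dir_deriv F u v = 0"
    and immersion: "u \<in> U \<Longrightarrow> inj (frechet_derivative F (at u))"
    and codim1: "CARD('m) = CARD('n) + 1"
    and induced_metric: "u \<in> U \<Longrightarrow> G u v w = dir_deriv F u v \<bullet> dir_deriv F u w"
begin

abbreviation "DF u v \<equiv> dir_deriv F u v"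
abbreviation "D\<nu> u v \<equiv> dir_deriv \<nu> u v"
abbreviation "DDF u v w \<equiv> dir_deriv2 F u v w"
abbreviation "DD\<nu> u v w \<equiv> dir_deriv2 \<nu> u v w"

lemma differentiable [simp]:
  assumes "u \<in> U"
  shows "F differentiable (at u)" "\<nu> differentiable (at u)"
    "(\<lambda>u. DF u v) differentiable (at u)" "(\<lambda>u. D\<nu> u v) differentiable (at u)"
  using assms smooth_on_imp_differentiable smooth_on_dir_deriv smooth_F smooth_\<nu> by blast+

lemmas DDF_linear = dir_deriv2_linear[OF openU smooth_F]
lemmas DDF_commute = dir_deriv2_commute[OF openU smooth_F]
lemmas DD\<nu>_linear = dir_deriv2_linear[OF openU smooth_\<nu>]
lemmas DD\<nu>_commute = dir_deriv2_commute[OF openU smooth_\<nu>]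

lemma linear_DF: "u \<in> U \<Longrightarrow> linear (frechet_derivative F (at u))"
  by (simp add: linear_frechet_derivative)

lemma DF_eq_0: "u \<in> U \<Longrightarrow> DF u v = 0 \<longleftrightarrow> v = 0"
  using immersion linear_DF by (metis linear_injective_0 linear_0)

text \<open>
  In codimension one the tangent space is a hyperplane, namely the orthogonal complement of the normal.
\<close>

lemma tangent_rep:
  assumes "u \<in> U" "a \<bullet> \<nu> u = 0"
  obtains v where "a = DF u v"
proof -
  let ?S = "range (frechet_derivative F (at u))" and ?T = "{x. \<nu> u \<bullet> x = 0}"
  have "\<nu> u \<noteq> 0" using \<nu>_unit[OF assms(1)] by auto
  then have "dim ?T = CARD('m) - 1" by (simp add: dim_hyperplane)
  moreover have "dim ?S = CARD('n)"
    using dim_image_eq[OF linear_DF[OF assms(1)], of UNIV] immersion[OF assms(1)] by simp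
  moreover have "?S \<subseteq> ?T" using \<nu>_normal[OF assms(1)] by auto
  moreover have "subspace ?S" using linear_subspace_image[OF linear_DF[OF assms(1)] subspace_UNIV] .
  ultimately have "?S = ?T"
    using subspace_dim_equal[of ?S ?T] subspace_hyperplane[of "\<nu> u"] codim1 by auto
  then show thesis using that assms(2) by (auto simp: inner_commute)
qed

lemma ambient_eqI:
  assumes "u \<in> U" "\<And>w. a \<bullet> DF u w = b \<bullet> DF u w" "a \<bullet> \<nu> u = b \<bullet> \<nu> u"
  shows "a = b"
proof -
  obtain v where v: "a - b = DF u v"
    using tangent_rep[OF assms(1), of "a - b"] assms(3) by (auto simp: inner_diff_left)
  have "(a - b) \<bullet> (a - b) = 0" using assms(2)[of v] unfolding v[symmetric] by (simp add: inner_diff_left)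
  then show ?thesis by simp
qed

lemma DF_eqI:
  assumes "u \<in> U" "\<And>w. DF u x \<bullet> DF u w = DF u y \<bullet> DF u w"
  shows "x = y"
proof -
  have "DF u x = DF u y" using ambient_eqI[OF assms] \<nu>_normal[OF assms(1)] by (simp add: inner_commute)
  then show ?thesis using immersion[OF assms(1)] by (simp add: inj_eq)
qed

lemma metric_matrix_nth: "u \<in> U \<Longrightarrow> metric_matrix G u $ i $ j = DF u (axis i 1) \<bullet> DF u (axis j 1)"
  by (simp add: metric_matrix_def induced_metric)

lemma metric_matrix_mult:
  assumes "u \<in> U" shows "(metric_matrix G u *v x) $ i = DF u (axis i 1) \<bullet> DF u x"
  unfolding matrix_vector_mult_def
  by (simp add: metric_matrix_nth assms dir_deriv_basis[of F u x] inner_sum_right mult.commute)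

lemma invertible_metric_matrix:
  assumes "u \<in> U" shows "invertible (metric_matrix G u)"
proof -
  have "x = 0" if "metric_matrix G u *v x = 0" for x
  proof -
    have "DF u x \<bullet> DF u (axis i 1) = DF u 0 \<bullet> DF u (axis i 1)" for i
      using metric_matrix_mult[OF assms, of x i] that DF_eq_0[OF assms, of 0] by (simp add: inner_commute)
    then have "DF u x \<bullet> DF u w = DF u 0 \<bullet> DF u w" for w
      by (simp add: dir_deriv_basis[OF differentiable(1)[OF assms], of w] inner_sum_right)
    then show ?thesis by (rule DF_eqI[OF assms])
  qed
  then show ?thesis by (simp add: invertible_left_inverse matrix_left_invertible_ker)
qed

lemma raise_index:
  assumes "u \<in> U"
  shows "(\<Sum>l\<in>UNIV. metric_inv G u $ k $ l * (DF u x \<bullet> DF u (axis l 1))) = x $ k"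
proof -
  have "metric_inv G u *v (metric_matrix G u *v x) = x"
    using matrix_inv_mult(2)[OF invertible_metric_matrix[OF assms]]
    by (simp add: metric_inv_def matrix_vector_mul_assoc)
  then have "(metric_inv G u *v (metric_matrix G u *v x)) $ k = x $ k" by simp
  then show ?thesis
    unfolding matrix_vector_mult_def[of "metric_inv G u"] by (simp add: metric_matrix_mult[OF assms] inner_commute)
qed

text \<open>
  The Christoffel symbols, the shape operator and the gradient are defined by raising an index; this rule replaces
  them by their inner products with tangent vectors.
\<close>

lemma metric_inv_sum:
  assumes "u \<in> U"
  shows "DF u (\<chi> k. \<Sum>l\<in>UNIV. metric_inv G u $ k $ l * a l) \<bullet> DF u w = (\<Sum>l\<in>UNIV. a l * w $ l)"
proof -
  let ?x = "metric_inv G u *v (\<chi> l. a l)"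
  have 1: "metric_matrix G u *v ?x = (\<chi> l. a l)"
    using matrix_inv_mult(1)[OF invertible_metric_matrix[OF assms]]
    by (simp add: metric_inv_def matrix_vector_mul_assoc)
  have "DF u ?x \<bullet> DF u (axis l 1) = a l" for l
    using metric_matrix_mult[OF assms, of ?x l] unfolding 1 by (simp add: inner_commute)
  then have "DF u ?x \<bullet> DF u w = (\<Sum>l\<in>UNIV. a l * w $ l)"
    by (simp add: dir_deriv_basis[OF differentiable(1)[OF assms], of w] inner_sum_right mult.commute)
  moreover have "?x = (\<chi> k. \<Sum>l\<in>UNIV. metric_inv G u $ k $ l * a l)"
    by (simp add: matrix_vector_mult_def vec_eq_iff)
  ultimately show ?thesis by simp
qed

lemma smooth_metric_matrix: "smooth_on U (\<lambda>u. metric_matrix G u $ i $ j)"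
  by (rule smooth_on_cong[OF openU _ metric_matrix_nth[symmetric]])
    (intro smooth_intros openU smooth_F)

lemma smooth_metric_inv: "smooth_on U (\<lambda>u. metric_inv G u $ k $ l)"
  unfolding metric_inv_def
  by (intro smooth_on_matrix_inv openU smooth_metric_matrix invertible_metric_matrix)

lemma smooth_christoffel: "smooth_on U (christoffel G k i j)"
proof -
  have "christoffel G k i j = (\<lambda>u. (\<Sum>l\<in>UNIV. metric_inv G u $ k $ l *
       (dir_deriv (\<lambda>u. metric_matrix G u $ j $ l) u (axis i 1)
        + dir_deriv (\<lambda>u. metric_matrix G u $ i $ l) u (axis j 1)
        - dir_deriv (\<lambda>u. metric_matrix G u $ i $ j) u (axis l 1))) / 2)"
    by (simp add: fun_eq_iff christoffel_def partial_def)
  then show ?thesis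
    by (simp only:) (intro smooth_intros openU smooth_metric_inv smooth_metric_matrix; simp)
qed

text \<open>
  The difference between the Levi-Civita connection and the flat connection of the chart.
\<close>

definition christoffel_vec :: "real^'n \<Rightarrow> real^'n \<Rightarrow> real^'n \<Rightarrow> real^'n"
  where "christoffel_vec u v w = (\<chi> k. \<Sum>i\<in>UNIV. \<Sum>j\<in>UNIV. christoffel G k i j u * v $ i * w $ j)"

lemma christoffel_vec_axis: "christoffel_vec u (axis i 1) (axis j 1) $ k = christoffel G k i j u"
  by (simp add: christoffel_vec_def axis_def if_distrib[of "\<lambda>x. _ * x"] cong: if_cong)

text \<open>
  The second fundamental form.
\<close>

definition sff :: "real^'n \<Rightarrow> real^'n \<Rightarrow> real^'n \<Rightarrow> real"
  where "sff u v w = DDF u v w \<bullet> \<nu> u"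

lemma D_metric:
  assumes "u \<in> U"
  shows "dir_deriv (\<lambda>u. metric_matrix G u $ j $ l) u v =
     DDF u v (axis j 1) \<bullet> DF u (axis l 1) + DF u (axis j 1) \<bullet> DDF u v (axis l 1)"
  by (subst frechet_derivative_cong_open[OF openU assms metric_matrix_nth], assumption)
    (simp add: dir_deriv_inner_fun assms)

lemma christoffel_eq:
  assumes "u \<in> U"
  shows "christoffel G k i j u =
    (\<Sum>l\<in>UNIV. metric_inv G u $ k $ l * (DDF u (axis i 1) (axis j 1) \<bullet> DF u (axis l 1)))"
proof -
  have "partial i (\<lambda>u. metric_matrix G u $ j $ l) u + partial j (\<lambda>u. metric_matrix G u $ i $ l) u
        - partial l (\<lambda>u. metric_matrix G u $ i $ j) u = 2 * (DDF u (axis i 1) (axis j 1) \<bullet> DF u (axis l 1))" for l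
    using DDF_commute[OF assms, of "axis i 1" "axis j 1"] DDF_commute[OF assms, of "axis i 1" "axis l 1"]
      DDF_commute[OF assms, of "axis j 1" "axis l 1"]
    by (simp add: partial_def D_metric[OF assms] inner_commute)
  then show ?thesis by (simp add: christoffel_def mult.left_commute sum_distrib_left[symmetric])
qed

lemma DDF_basis:
  assumes "u \<in> U"
  shows "DDF u v w = (\<Sum>i\<in>UNIV. \<Sum>j\<in>UNIV. (v $ i * w $ j) *\<^sub>R DDF u (axis i 1) (axis j 1))"
proof -
  have l: "linear (DDF u v)" using DDF_linear[OF assms] by (intro linearI) auto
  have "DDF u v w = (\<Sum>j\<in>UNIV. w $ j *\<^sub>R DDF u v (axis j 1))"
    by (subst vec_basis_expansion[of w]) (simp add: linear_sum[OF l] linear_cmul[OF l])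
  also have "\<dots> = (\<Sum>j\<in>UNIV. w $ j *\<^sub>R (\<Sum>i\<in>UNIV. v $ i *\<^sub>R DDF u (axis i 1) (axis j 1)))"
    by (subst dir_deriv_basis[of _ u v]) (simp_all add: assms)
  also have "\<dots> = (\<Sum>j\<in>UNIV. \<Sum>i\<in>UNIV. (v $ i * w $ j) *\<^sub>R DDF u (axis i 1) (axis j 1))"
    by (simp add: scaleR_sum_right mult.commute)
  finally show ?thesis by (subst sum.swap)
qed

text \<open>
  The Christoffel symbols are defined from derivatives of the metric, hence from tangential components of second
  derivatives of \<open>F\<close>; so \<open>christoffel_vec\<close> is the tangent part of the second derivative.
\<close>

lemma gauss_formula:
  assumes "u \<in> U"
  shows "DDF u v w = DF u (christoffel_vec u v w) + sff u v w *\<^sub>R \<nu> u"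
proof (rule ambient_eqI[OF assms])
  fix t
  have "christoffel_vec u v w = (\<chi> k. \<Sum>l\<in>UNIV. metric_inv G u $ k $ l * (DDF u v w \<bullet> DF u (axis l 1)))"
  proof -
    have "(\<Sum>i\<in>UNIV. \<Sum>j\<in>UNIV. christoffel G k i j u * v $ i * w $ j) =
       (\<Sum>l\<in>UNIV. metric_inv G u $ k $ l * (DDF u v w \<bullet> DF u (axis l 1)))" for k
    proof -
      have "(\<Sum>i\<in>UNIV. \<Sum>j\<in>UNIV. christoffel G k i j u * v $ i * w $ j) =
        (\<Sum>i\<in>UNIV. \<Sum>j\<in>UNIV. \<Sum>l\<in>UNIV. metric_inv G u $ k $ l *
            ((v $ i * w $ j) * (DDF u (axis i 1) (axis j 1) \<bullet> DF u (axis l 1))))"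
        by (simp add: christoffel_eq[OF assms] sum_distrib_left sum_distrib_right mult_ac)
      also have "\<dots> = (\<Sum>i\<in>UNIV. \<Sum>l\<in>UNIV. \<Sum>j\<in>UNIV. metric_inv G u $ k $ l *
            ((v $ i * w $ j) * (DDF u (axis i 1) (axis j 1) \<bullet> DF u (axis l 1))))"
        by (intro sum.cong refl sum.swap)
      also have "\<dots> = (\<Sum>l\<in>UNIV. \<Sum>i\<in>UNIV. \<Sum>j\<in>UNIV. metric_inv G u $ k $ l *
            ((v $ i * w $ j) * (DDF u (axis i 1) (axis j 1) \<bullet> DF u (axis l 1))))"
        by (rule sum.swap)
      also have "\<dots> = (\<Sum>l\<in>UNIV. metric_inv G u $ k $ l * (DDF u v w \<bullet> DF u (axis l 1)))"
        by (subst (2) DDF_basis[OF assms]) (simp add: inner_sum_left sum_distrib_left)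
      finally show ?thesis .
    qed
    then show ?thesis by (simp add: christoffel_vec_def)
  qed
  then have "DF u (christoffel_vec u v w) \<bullet> DF u t = (\<Sum>l\<in>UNIV. (DDF u v w \<bullet> DF u (axis l 1)) * t $ l)"
    by (simp only: metric_inv_sum[OF assms])
  also have "\<dots> = DDF u v w \<bullet> DF u t"
    by (simp add: dir_deriv_basis[OF differentiable(1)[OF assms], of t] inner_sum_right mult.commute)
  finally show "DDF u v w \<bullet> DF u t = (DF u (christoffel_vec u v w) + sff u v w *\<^sub>R \<nu> u) \<bullet> DF u t"
    by (simp add: inner_add_left \<nu>_normal[OF assms])
next
  show "DDF u v w \<bullet> \<nu> u = (DF u (christoffel_vec u v w) + sff u v w *\<^sub>R \<nu> u) \<bullet> \<nu> u"
    unfolding inner_add_left inner_scaleR_left inner_commute[of "DF u (christoffel_vec u v w)"] \<nu>_normal[OF assms]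
      \<nu>_unit[OF assms] sff_def by simp
qed

lemma sff_sym: "u \<in> U \<Longrightarrow> sff u v w = sff u w v"
  using DDF_commute by (simp add: sff_def)

lemma christoffel_vec_sym: "u \<in> U \<Longrightarrow> christoffel_vec u v w = christoffel_vec u w v"
  by (intro DF_eqI) (use gauss_formula[of u v w] gauss_formula[of u w v] sff_sym[of u v w] DDF_commute[of u v w] in auto)

lemma sff_weingarten:
  assumes "u \<in> U"
  shows "sff u v w = - (D\<nu> u v \<bullet> DF u w)"
proof -
  have "dir_deriv (\<lambda>u. \<nu> u \<bullet> DF u w) u v = 0"
    by (subst frechet_derivative_cong_open[OF openU assms \<nu>_normal]) auto
  then show ?thesis using assms by (simp add: dir_deriv_inner_fun sff_def inner_commute)
qed

lemma D\<nu>_tangent: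
  assumes "u \<in> U" shows "D\<nu> u v \<bullet> \<nu> u = 0" "\<nu> u \<bullet> D\<nu> u v = 0"
proof -
  have "dir_deriv (\<lambda>u. \<nu> u \<bullet> \<nu> u) u v = 0"
    by (subst frechet_derivative_cong_open[OF openU assms \<nu>_unit]) auto
  then show "D\<nu> u v \<bullet> \<nu> u = 0" using assms by (simp add: dir_deriv_inner_fun inner_commute)
  then show "\<nu> u \<bullet> D\<nu> u v = 0" by (simp add: inner_commute)
qed

lemma bilinear_sff: "u \<in> U \<Longrightarrow> bilinear (sff u)"
  unfolding bilinear_def
  by (auto intro!: linearI simp: sff_def DDF_linear inner_add_left)

lemma levi_civita_eq:
  assumes "u \<in> U" "Y differentiable (at u)"
  shows "DF u (levi_civita G X Y u) =
    dir_deriv (\<lambda>u. DF u (Y u)) u (X u) - sff u (X u) (Y u) *\<^sub>R \<nu> u"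
proof -
  have "levi_civita G X Y u = dir_deriv Y u (X u) + christoffel_vec u (X u) (Y u)"
    by (simp add: levi_civita_def christoffel_vec_def)
  then show ?thesis
    using dir_deriv_along_field(1)[OF openU smooth_F assms, of "X u"] gauss_formula[OF assms(1), where v = "X u" and w = "Y u"]
    by (simp add: assms(1))
qed

lemma smooth_levi_civita:
  assumes "smooth_on U X" "smooth_on U Y"
  shows "smooth_on U (levi_civita G X Y)"
proof -
  have "levi_civita G X Y = (\<lambda>u. dir_deriv Y u (X u) +
    (\<chi> k. \<Sum>i\<in>UNIV. \<Sum>j\<in>UNIV. christoffel G k i j u * X u $ i * Y u $ j))"
    by (simp add: fun_eq_iff levi_civita_def)
  then show ?thesis
    by (simp only:) (intro smooth_intros smooth_on_vec_nth openU smooth_christoffel assms)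
qed

lemma smooth_sff: "smooth_on U X \<Longrightarrow> smooth_on U Y \<Longrightarrow> smooth_on U (\<lambda>u. sff u (X u) (Y u))"
proof -
  assume a: "smooth_on U X" "smooth_on U Y"
  show ?thesis
  proof (rule smooth_on_cong[OF openU])
    show "smooth_on U (\<lambda>u. - (D\<nu> u (X u) \<bullet> DF u (Y u)))"
      by (intro smooth_intros openU smooth_F smooth_\<nu> a)
  qed (simp add: sff_weingarten)
qed

text \<open>
  Write \<open>\<zeta> = dF(Z)\<close>.  Covariant derivatives are tangent parts of ordinary derivatives of \<open>\<zeta>\<close>.  The ordinary
  second derivatives of \<open>\<zeta>\<close> cancel in the curvature because they are symmetric, and what remains comes from
  differentiating the normal components that were removed.
\<close>

theorem gauss_equation:
  assumes u: "u \<in> U" and X: "smooth_on U X" and Y: "smooth_on U Y" and Z: "smooth_on U Z"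
  shows "DF u (curvature G X Y Z u) =
    sff u (X u) (Z u) *\<^sub>R D\<nu> u (Y u) - sff u (Y u) (Z u) *\<^sub>R D\<nu> u (X u)"
proof -
  define \<zeta> where "\<zeta> u = DF u (Z u)" for u
  have \<zeta>: "smooth_on U \<zeta>" unfolding \<zeta>_def by (intro smooth_intros openU smooth_F Z)
  have LZ: "DF u (levi_civita G X Z u) = dir_deriv \<zeta> u (X u) - sff u (X u) (Z u) *\<^sub>R \<nu> u"
    if "u \<in> U" for X u
    using levi_civita_eq[OF that smooth_on_imp_differentiable[OF Z that]] by (simp add: \<zeta>_def[abs_def])
  have LLZ: "DF u (levi_civita G X (levi_civita G Y Z) u) \<bullet> DF u t =
      (dir_deriv2 \<zeta> u (X u) (Y u) + dir_deriv \<zeta> u (dir_deriv Y u (X u))) \<bullet> DF u t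
      - sff u (Y u) (Z u) * (D\<nu> u (X u) \<bullet> DF u t)"
    if X: "smooth_on U X" and Y: "smooth_on U Y" for X Y t
  proof -
    note d = smooth_on_imp_differentiable[OF smooth_levi_civita[OF Y Z] u]
    have ds: "(\<lambda>u. sff u (Y u) (Z u)) differentiable (at u)"
      by (rule smooth_on_imp_differentiable[OF smooth_sff[OF Y Z] u])
    have "dir_deriv (\<lambda>u. DF u (levi_civita G Y Z u)) u (X u)
        = dir_deriv (\<lambda>u. dir_deriv \<zeta> u (Y u) - sff u (Y u) (Z u) *\<^sub>R \<nu> u) u (X u)"
      by (subst frechet_derivative_cong_open[OF openU u LZ]) auto
    also have "\<dots> = dir_deriv2 \<zeta> u (X u) (Y u) + dir_deriv \<zeta> u (dir_deriv Y u (X u))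
        - (sff u (Y u) (Z u) *\<^sub>R D\<nu> u (X u) + dir_deriv (\<lambda>u. sff u (Y u) (Z u)) u (X u) *\<^sub>R \<nu> u)"
      using dir_deriv_along_field[OF openU \<zeta> u smooth_on_imp_differentiable[OF Y u]] ds u
      by (subst dir_deriv_diff_fun) (auto intro: differentiable_scaleR simp: dir_deriv_scaleR_fun)
    finally show ?thesis
      unfolding levi_civita_eq[OF u d] using \<nu>_normal[OF u]
      by (simp add: inner_diff_left inner_add_left)
  qed
  have comm: "dir_deriv2 \<zeta> u (X u) (Y u) = dir_deriv2 \<zeta> u (Y u) (X u)"
    by (rule dir_deriv2_commute[OF openU \<zeta> u])
  have lin: "dir_deriv \<zeta> u (lie_bracket X Y u) =
      dir_deriv \<zeta> u (dir_deriv Y u (X u)) - dir_deriv \<zeta> u (dir_deriv X u (Y u))"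
    using smooth_on_imp_differentiable[OF \<zeta> u] by (simp add: lie_bracket_def)
  show ?thesis
  proof (rule ambient_eqI[OF u])
    fix t
    show "DF u (curvature G X Y Z u) \<bullet> DF u t =
      (sff u (X u) (Z u) *\<^sub>R D\<nu> u (Y u) - sff u (Y u) (Z u) *\<^sub>R D\<nu> u (X u)) \<bullet> DF u t"
      using u LLZ[OF X Y] LLZ[OF Y X] LZ[OF u, of "lie_bracket X Y"] comm lin \<nu>_normal[OF u, of t]
      by (simp add: curvature_def inner_diff_left inner_add_left)
  qed (use D\<nu>_tangent[OF u] \<nu>_normal[OF u] in \<open>simp add: inner_diff_left inner_diff_right inner_commute\<close>)
qed

section \<open>Codazzi equation, derivative of the curvature, and metric traces\<close>

text \<open>
  Up to sign, the second covariant derivative of \<open>\<nu>\<close> tested against a tangent vector.  By \<open>nabla_sff_eq\<close> below, this is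
  the covariant derivative of the second fundamental form; in this shape its symmetry in the first two arguments, the
  Codazzi equation, is the symmetry of second derivatives of \<open>\<nu>\<close>.
\<close>

definition nabla_sff :: "real^'n \<Rightarrow> real^'n \<Rightarrow> real^'n \<Rightarrow> real^'n \<Rightarrow> real"
  where "nabla_sff u v y w = - ((DD\<nu> u v y - D\<nu> u (christoffel_vec u v y)) \<bullet> DF u w)"

lemma nabla_sff_eq:
  assumes "u \<in> U"
  shows "dir_deriv (\<lambda>u. sff u y w) u v = nabla_sff u v y w + sff u (christoffel_vec u v y) w + sff u y (christoffel_vec u v w)"
proof -
  have "dir_deriv (\<lambda>u. sff u y w) u v = dir_deriv (\<lambda>u. 0 - D\<nu> u y \<bullet> DF u w) u v"
    by (subst frechet_derivative_cong_open[OF openU assms sff_weingarten]) auto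
  also have "\<dots> = - (D\<nu> u y \<bullet> DDF u v w + DD\<nu> u v y \<bullet> DF u w)"
    using assms by (subst dir_deriv_diff_fun) (auto simp: dir_deriv_inner_fun)
  also have "D\<nu> u y \<bullet> DDF u v w = - sff u y (christoffel_vec u v w)"
    using assms by (simp add: gauss_formula[where v=v and w=w] sff_weingarten inner_add_right inner_diff_right D\<nu>_tangent)
  also have "DD\<nu> u v y \<bullet> DF u w = - nabla_sff u v y w - sff u (christoffel_vec u v y) w"
    by (simp add: nabla_sff_def sff_weingarten assms inner_diff_left)
  finally show ?thesis by simp
qed

lemma nabla_sff_sym12: "u \<in> U \<Longrightarrow> nabla_sff u v y w = nabla_sff u y v w"
  unfolding nabla_sff_def using DD\<nu>_commute christoffel_vec_sym by simp

lemma nabla_sff_sym23: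
  assumes "u \<in> U" shows "nabla_sff u v y w = nabla_sff u v w y"
proof -
  have "dir_deriv (\<lambda>u. sff u y w) u v = dir_deriv (\<lambda>u. sff u w y) u v"
    by (subst frechet_derivative_cong_open[OF openU assms sff_sym]) auto
  then show ?thesis
    unfolding nabla_sff_eq[OF assms] using sff_sym[OF assms] by (simp add: add.commute)
qed

lemma linear_christoffel_vec: "linear (christoffel_vec u v)"
  by (rule linearI) (simp_all add: christoffel_vec_def vec_eq_iff sum.distrib distrib_left sum_distrib_left mult_ac)

lemma bilinear_nabla_sff: "u \<in> U \<Longrightarrow> bilinear (nabla_sff u v)"
  unfolding bilinear_def
  by (auto intro!: linearI simp: nabla_sff_def DD\<nu>_linear linear_add[OF linear_christoffel_vec] linear_cmul[OF linear_christoffel_vec]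
      inner_add_right inner_diff_left inner_add_left algebra_simps)

lemma levi_civita_const: "levi_civita G (\<lambda>_. a) (\<lambda>_. y) = (\<lambda>u. christoffel_vec u a y)"
  by (simp add: fun_eq_iff levi_civita_def christoffel_vec_def)

lemma smooth_christoffel_vec: "smooth_on U (\<lambda>u. christoffel_vec u v w)"
  using smooth_levi_civita[OF smooth_on_const smooth_on_const] by (simp add: levi_civita_const)

lemma smooth_curvature:
  assumes "smooth_on U X" "smooth_on U Y" "smooth_on U Z"
  shows "smooth_on U (curvature G X Y Z)"
proof -
  have 1: "curvature G X Y Z = (\<lambda>u. levi_civita G X (levi_civita G Y Z) u
    - levi_civita G Y (levi_civita G X Z) u - levi_civita G (lie_bracket X Y) Z u)"
    by (simp add: fun_eq_iff curvature_def)
  have 2: "lie_bracket X Y = (\<lambda>u. dir_deriv Y u (X u) - dir_deriv X u (Y u))"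
    by (simp add: fun_eq_iff lie_bracket_def)
  have "smooth_on U (lie_bracket X Y)" unfolding 2 by (intro smooth_intros openU assms)
  then show ?thesis unfolding 1 by (intro smooth_intros smooth_levi_civita openU assms)
qed

text \<open>
  The derivative of the Gauss equation.  Constant coordinate fields suffice, but their covariant derivatives are
  not constant, so the Gauss equation is needed for general smooth fields.
\<close>

lemma cov_curvature_eq:
  assumes u: "u \<in> U"
  shows "DF u (cov_curvature G (\<lambda>_. a) (\<lambda>_. y) (\<lambda>_. z) (\<lambda>_. w) u) \<bullet> DF u t =
    nabla_sff u a z w * sff u y t + sff u z w * nabla_sff u a y t
    - nabla_sff u a y w * sff u z t - sff u y w * nabla_sff u a z t"
proof -
  let ?Q = "curvature G (\<lambda>_. y) (\<lambda>_. z) (\<lambda>_. w)"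
  have sQ: "smooth_on U ?Q" by (intro smooth_curvature smooth_on_const)
  have d: "(\<lambda>u. sff u y w) differentiable (at u)" for y w
    by (rule smooth_on_imp_differentiable[OF smooth_sff[OF smooth_on_const smooth_on_const] u])
  have Q: "DF u (?Q u) = sff u y w *\<^sub>R D\<nu> u z - sff u z w *\<^sub>R D\<nu> u y" if "u \<in> U" for u
    using gauss_equation[OF that] smooth_on_const by blast
  have "DF u (levi_civita G (\<lambda>_. a) ?Q u) \<bullet> DF u t = dir_deriv (\<lambda>u. DF u (?Q u)) u a \<bullet> DF u t"
    unfolding levi_civita_eq[OF u smooth_on_imp_differentiable[OF sQ u]]
    by (simp add: inner_diff_left \<nu>_normal[OF u])
  also have "dir_deriv (\<lambda>u. DF u (?Q u)) u a = dir_deriv (\<lambda>u. sff u y w *\<^sub>R D\<nu> u z - sff u z w *\<^sub>R D\<nu> u y) u a"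
    by (subst frechet_derivative_cong_open[OF openU u Q]) auto
  also have "\<dots> = (sff u y w *\<^sub>R DD\<nu> u a z + dir_deriv (\<lambda>u. sff u y w) u a *\<^sub>R D\<nu> u z)
       - (sff u z w *\<^sub>R DD\<nu> u a y + dir_deriv (\<lambda>u. sff u z w) u a *\<^sub>R D\<nu> u y)"
    using u d by (subst dir_deriv_diff_fun) (auto intro: differentiable_scaleR simp: dir_deriv_scaleR_fun)
  finally have 1: "DF u (levi_civita G (\<lambda>_. a) ?Q u) \<bullet> DF u t =
      sff u y w * (DD\<nu> u a z \<bullet> DF u t) - dir_deriv (\<lambda>u. sff u y w) u a * sff u z t
      - sff u z w * (DD\<nu> u a y \<bullet> DF u t) + dir_deriv (\<lambda>u. sff u z w) u a * sff u y t"
    by (simp add: inner_diff_left inner_add_left sff_weingarten[OF u])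
  have 2: "DD\<nu> u a y \<bullet> DF u t = - nabla_sff u a y t - sff u (christoffel_vec u a y) t" for y
    by (simp add: nabla_sff_def sff_weingarten u inner_diff_left)
  note ge = gauss_equation[OF u]
  have 3: "DF u (curvature G (\<lambda>u. christoffel_vec u a y) (\<lambda>_. z) (\<lambda>_. w) u) \<bullet> DF u t =
      - (sff u (christoffel_vec u a y) w * sff u z t) + sff u z w * sff u (christoffel_vec u a y) t"
    by (subst ge) (auto intro!: smooth_christoffel_vec smooth_on_const simp: inner_diff_left sff_weingarten[OF u])
  have 4: "DF u (curvature G (\<lambda>_. y) (\<lambda>u. christoffel_vec u a z) (\<lambda>_. w) u) \<bullet> DF u t =
      - (sff u y w * sff u (christoffel_vec u a z) t) + sff u (christoffel_vec u a z) w * sff u y t"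
    by (subst ge) (auto intro!: smooth_christoffel_vec smooth_on_const simp: inner_diff_left sff_weingarten[OF u])
  have 5: "DF u (curvature G (\<lambda>_. y) (\<lambda>_. z) (\<lambda>u. christoffel_vec u a w) u) \<bullet> DF u t =
      - (sff u y (christoffel_vec u a w) * sff u z t) + sff u z (christoffel_vec u a w) * sff u y t"
    by (subst ge) (auto intro!: smooth_christoffel_vec smooth_on_const simp: inner_diff_left sff_weingarten[OF u])
  show ?thesis
    unfolding cov_curvature_def levi_civita_const
    by (simp add: u inner_diff_left 1 3 4 5 2 nabla_sff_eq[OF u]) (simp add: algebra_simps)
qed

definition metric_trace :: "real^'n \<Rightarrow> (real^'n \<Rightarrow> real^'n \<Rightarrow> real) \<Rightarrow> real"
  where "metric_trace u b = (\<Sum>i\<in>UNIV. \<Sum>j\<in>UNIV. metric_inv G u $ i $ j * b (axis i 1) (axis j 1))"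

text \<open>
  A basis that is orthonormal at the one point \<open>u\<close>, obtained by pulling an orthonormal basis of the tangent
  hyperplane back through \<open>dF\<close>.  It turns traces with respect to the metric into sums of diagonal entries.
\<close>

lemma orthonormal_frame:
  assumes u: "u \<in> U"
  obtains E :: "real^'n \<Rightarrow> real^'n" where "linear E" "surj E" "\<And>v w. DF u (E v) \<bullet> DF u (E w) = v \<bullet> w"
    "\<And>b. bilinear b \<Longrightarrow> metric_trace u b = (\<Sum>c\<in>Basis. b (E c) (E c))"
proof -
  let ?S = "range (frechet_derivative F (at u))"
  have sub: "subspace ?S" using linear_subspace_image[OF linear_DF[OF u] subspace_UNIV] .
  have "dim ?S = CARD('n)"
    using dim_image_eq[OF linear_DF[OF u], of UNIV] immersion[OF u] by simp
  then have d: "dim (UNIV :: (real^'n) set) = dim ?S" by simp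
  obtain f :: "real^'n \<Rightarrow> real^'m" where f: "linear f" "f ` UNIV = ?S" "\<And>x. x \<in> UNIV \<Longrightarrow> norm (f x) = norm x"
    using isometry_subspaces[OF subspace_UNIV sub d] by blast
  have f_inner: "f v \<bullet> f w = v \<bullet> w" for v w
    using f(3)[of "v + w"] f(3)[of v] f(3)[of w] by (simp add: dot_norm linear_add[OF f(1)])
  define E where "E v = (SOME x. DF u x = f v)" for v
  have DE: "DF u (E v) = f v" for v
    unfolding E_def by (rule someI_ex) (use f(2) in \<open>metis (mono_tags, lifting) rangeE rangeI\<close>)
  have inj: "x = y" if "DF u x = DF u y" for x y using immersion[OF u] that by (simp add: inj_eq)
  have lin: "linear E"
    by (intro linearI inj) (simp_all add: DE u linear_add[OF f(1)] linear_cmul[OF f(1)])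
  have surj: "surj E"
    unfolding surj_def
  proof
    fix y
    obtain w where "f w = DF u y" using f(2) by (metis (mono_tags, lifting) imageE rangeI)
    then have "E w = y" by (intro inj) (simp add: DE)
    then show "\<exists>x. y = E x" by blast
  qed
  have iE: "DF u (E v) \<bullet> DF u (E w) = v \<bullet> w" for v w by (simp add: DE f_inner)
  have minv: "metric_inv G u $ i $ j = (\<Sum>c\<in>Basis. E c $ i * E c $ j)" for i j
  proof -
    define x where "x = (\<Sum>c\<in>Basis. E c $ j *\<^sub>R E c)"
    have "DF u x \<bullet> DF u (axis l 1) = (if l = j then 1 else 0)" for l
    proof -
      obtain w where w: "axis l 1 = E w" using surj by (metis surjD)
      have "DF u x = (\<Sum>c\<in>Basis. E c $ j *\<^sub>R DF u (E c))"
        unfolding x_def by (simp add: linear_sum[OF linear_DF[OF u]] u)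
      then have "DF u x \<bullet> DF u (axis l 1) = (\<Sum>c\<in>Basis. E c $ j * (c \<bullet> w))"
        by (simp add: w inner_sum_left iE)
      also have "\<dots> = E (\<Sum>c\<in>Basis. (w \<bullet> c) *\<^sub>R c) $ j"
        by (simp add: linear_sum[OF lin] linear_cmul[OF lin] inner_commute mult.commute)
      also have "\<dots> = axis l 1 $ j" by (simp add: euclidean_representation w)
      finally show ?thesis by (simp add: axis_def)
    qed
    note 1 = this
    have "metric_inv G u $ i $ j = x $ i"
      unfolding raise_index[OF u, of i x, symmetric] 1 by (simp add: if_distrib cong: if_cong)
    then show ?thesis by (simp add: x_def mult.commute)
  qed
  have "metric_trace u b = (\<Sum>c\<in>Basis. b (E c) (E c))" if b: "bilinear b" for b
  proof -
    have bE: "b v v = (\<Sum>i\<in>UNIV. \<Sum>j\<in>UNIV. v $ i * v $ j * b (axis i 1) (axis j 1))" for v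
    proof -
      have "b v v = b (\<Sum>i\<in>UNIV. v $ i *\<^sub>R axis i 1) (\<Sum>i\<in>UNIV. v $ i *\<^sub>R axis i 1)"
        by (simp flip: vec_basis_expansion)
      then show ?thesis
        by (simp add: bilinear_sum[OF b] bilinear_lmul[OF b] bilinear_rmul[OF b] sum.cartesian_product mult_ac)
    qed
    have "metric_trace u b = (\<Sum>i\<in>UNIV. \<Sum>j\<in>UNIV. \<Sum>c\<in>Basis. E c $ i * E c $ j * b (axis i 1) (axis j 1))"
      by (simp add: metric_trace_def minv sum_distrib_right)
    also have "\<dots> = (\<Sum>i\<in>UNIV. \<Sum>c\<in>Basis. \<Sum>j\<in>UNIV. E c $ i * E c $ j * b (axis i 1) (axis j 1))"
      by (intro sum.cong refl sum.swap)
    also have "\<dots> = (\<Sum>c\<in>Basis. \<Sum>i\<in>UNIV. \<Sum>j\<in>UNIV. E c $ i * E c $ j * b (axis i 1) (axis j 1))"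
      by (rule sum.swap)
    finally show ?thesis by (simp flip: bE)
  qed
  then show thesis by (rule that[OF lin surj iE])
qed

lemma metric_trace_eq_trace:
  assumes "u \<in> U"
  shows "metric_trace u (\<lambda>v w. DF u (B v) \<bullet> DF u w) = (\<Sum>i\<in>UNIV. B (axis i 1) $ i)"
  unfolding metric_trace_def by (simp add: raise_index[OF assms])

text \<open>
  The shape operator in coordinates.
\<close>

definition shape :: "real^'n \<Rightarrow> real^'n \<Rightarrow> real^'n"
  where "shape u w = (\<chi> k. \<Sum>l\<in>UNIV. metric_inv G u $ k $ l * sff u w (axis l 1))"

lemma sff_basis: "u \<in> U \<Longrightarrow> sff u v w = (\<Sum>l\<in>UNIV. sff u v (axis l 1) * w $ l)"
  by (simp add: sff_weingarten dir_deriv_basis[of F u w] inner_sum_right sum_negf mult.commute)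

lemma DF_shape:
  assumes "u \<in> U"
  shows "DF u (shape u w) = - D\<nu> u w"
proof (rule ambient_eqI[OF assms])
  fix t
  show "DF u (shape u w) \<bullet> DF u t = - D\<nu> u w \<bullet> DF u t"
    unfolding shape_def metric_inv_sum[OF assms] sff_basis[OF assms, symmetric]
    by (simp add: sff_weingarten[OF assms])
next
  show "DF u (shape u w) \<bullet> \<nu> u = - D\<nu> u w \<bullet> \<nu> u"
    using \<nu>_normal[OF assms, of "shape u w"] by (simp add: D\<nu>_tangent[OF assms] inner_commute)
qed

lemma DF_shape_inner: "u \<in> U \<Longrightarrow> DF u (shape u w) \<bullet> DF u t = sff u w t"
  by (simp add: DF_shape sff_weingarten)

lemma linear_shape: "u \<in> U \<Longrightarrow> linear (shape u)"
  by (intro linearI) (simp_all add: shape_def vec_eq_iff bilinear_ladd[OF bilinear_sff] bilinear_lmul[OF bilinear_sff]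
      distrib_left sum.distrib sum_distrib_left mult_ac)

lemma smooth_shape: "smooth_on U (\<lambda>u. shape u w)"
  unfolding shape_def by (intro smooth_intros smooth_metric_inv smooth_sff openU)

text \<open>
  Minus half the trace of the shape operator.  With this normalisation the gradient of \<open>lam\<close> will be an
  eigenvector with eigenvalue \<open>lam\<close>.
\<close>

definition lam :: "real^'n \<Rightarrow> real"
  where "lam u = (- 1 / 2) * (\<Sum>i\<in>UNIV. shape u (axis i 1) $ i)"

lemma smooth_lam: "smooth_on U lam"
  unfolding lam_def[abs_def] by (intro smooth_intros smooth_on_vec_nth smooth_shape openU)

lemma metric_trace_sff: "u \<in> U \<Longrightarrow> metric_trace u (sff u) = - 2 * lam u"
  using metric_trace_eq_trace[of u "shape u"] by (simp add: DF_shape_inner lam_def)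

text \<open>
  The coordinate derivative of the shape operator differs from its covariant derivative by a commutator with
  the connection, which does not contribute to the trace.
\<close>

lemma metric_trace_nabla_sff:
  assumes u: "u \<in> U"
  shows "metric_trace u (nabla_sff u v) = - 2 * dir_deriv lam u v"
proof -
  \<comment> \<open>The coordinate derivative of the shape operator along \<open>v\<close>.\<close>
  define B where "B w = dir_deriv (\<lambda>u. shape u w) u v" for w
  have d: "(\<lambda>u. shape u w) differentiable (at u)" for w
    by (rule smooth_on_imp_differentiable[OF smooth_shape u])
  have B: "DF u (B w) \<bullet> DF u t = nabla_sff u v w t + DF u (shape u (christoffel_vec u v w)) \<bullet> DF u t
      - DF u (christoffel_vec u v (shape u w)) \<bullet> DF u t" for w t
  proof -
    have "dir_deriv (\<lambda>u. DF u (shape u w)) u v = dir_deriv (\<lambda>u. 0 - D\<nu> u w) u v"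
      by (subst frechet_derivative_cong_open[OF openU u DF_shape]) auto
    also have "\<dots> = - DD\<nu> u v w" using u by (subst dir_deriv_diff_fun) auto
    finally have "DDF u v (shape u w) + DF u (B w) = - DD\<nu> u v w"
      using dir_deriv_along_field(1)[OF openU smooth_F u d] by (simp add: B_def)
    then have "DF u (B w) = - DD\<nu> u v w - DDF u v (shape u w)" by (simp add: algebra_simps)
    then have "DF u (B w) \<bullet> DF u t = (- DD\<nu> u v w - DDF u v (shape u w)) \<bullet> DF u t" by (simp only:)
    also have "\<dots> = nabla_sff u v w t + DF u (shape u (christoffel_vec u v w)) \<bullet> DF u t - DF u (christoffel_vec u v (shape u w)) \<bullet> DF u t"
      unfolding gauss_formula[OF u, where v=v and w="shape u w"]
      by (simp add: inner_diff_left inner_add_left nabla_sff_def DF_shape[OF u] \<nu>_normal[OF u])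
    finally show ?thesis .
  qed
  have "(\<Sum>i\<in>UNIV. B (axis i 1) $ i) = metric_trace u (nabla_sff u v)
      + ((\<Sum>i\<in>UNIV. shape u (christoffel_vec u v (axis i 1)) $ i) - (\<Sum>i\<in>UNIV. christoffel_vec u v (shape u (axis i 1)) $ i))"
    unfolding metric_trace_eq_trace[OF u, symmetric] metric_trace_eq_trace[OF u, symmetric, of "\<lambda>i. shape u (christoffel_vec u v i)"]
      metric_trace_eq_trace[OF u, symmetric, of "\<lambda>i. christoffel_vec u v (shape u i)"] B metric_trace_def
    by (simp add: distrib_left right_diff_distrib sum.distrib sum_subtractf)
  also have "\<dots> = metric_trace u (nabla_sff u v)"
    using trace_commute[OF linear_shape[OF u] linear_christoffel_vec] by simp
  finally have "metric_trace u (nabla_sff u v) = (\<Sum>i\<in>UNIV. B (axis i 1) $ i)" by simp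
  moreover have "dir_deriv lam u v = - (\<Sum>i\<in>UNIV. B (axis i 1) $ i) / 2"
  proof -
    have "(lam has_derivative (\<lambda>v. (- 1 / 2) * (\<Sum>i\<in>UNIV. dir_deriv (\<lambda>u. shape u (axis i 1)) u v $ i))) (at u)"
      unfolding lam_def[abs_def]
      by (intro has_derivative_mult_right has_derivative_sum
          bounded_linear.has_derivative[OF bounded_linear_vec_nth] frechet_derivative_works[THEN iffD1] d)
    then have "dir_deriv lam u v = (- 1 / 2) * (\<Sum>i\<in>UNIV. B (axis i 1) $ i)"
      unfolding B_def by (rule dir_deriv_eqI)
    then show ?thesis by simp
  qed
  ultimately show ?thesis by simp
qed

section \<open>Biharmonicity and recurrence on a patch\<close>

lemma laplacian_vec_eq:
  assumes u: "u \<in> U" and P: "smooth_on U P" and P': "\<And>u. u \<in> U \<Longrightarrow> P' u = P u"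
  shows "laplacian_vec G P' u $ a =
    - metric_trace u (\<lambda>v w. (dir_deriv2 P u v w - dir_deriv P u (christoffel_vec u v w)) $ a)"
proof -
  have dP: "P differentiable (at u)" "(\<lambda>u. dir_deriv P u w) differentiable (at u)" if "u \<in> U" for u w
    using that P smooth_on_imp_differentiable smooth_on_dir_deriv by blast+
  have p1: "partial j (\<lambda>u. P' u $ a) u = dir_deriv P u (axis j 1) $ a" if "u \<in> U" for u j
    unfolding partial_def using that
    by (subst frechet_derivative_cong_open[OF openU that, where g = "\<lambda>u. P u $ a"]) (simp_all add: P' dir_deriv_vec_nth dP)
  have p2: "partial i (partial j (\<lambda>u. P' u $ a)) u = dir_deriv2 P u (axis i 1) (axis j 1) $ a" for i j
    unfolding partial_def[of i]
    by (subst frechet_derivative_cong_open[OF openU u p1]) (simp_all add: dir_deriv_vec_nth dP u)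
  have "dir_deriv P u (christoffel_vec u (axis i 1) (axis j 1)) $ a =
      (\<Sum>k\<in>UNIV. christoffel G k i j u * partial k (\<lambda>u. P' u $ a) u)" for i j
    unfolding dir_deriv_basis[OF dP(1)[OF u], of "christoffel_vec u (axis i 1) (axis j 1)"] by (simp add: christoffel_vec_axis p1 u)
  then show ?thesis
    by (simp add: laplacian_vec_def laplacian_def metric_trace_def p2)
qed

lemma metric_trace_sum: "metric_trace u (\<lambda>v w. \<Sum>a\<in>A. b a v w) = (\<Sum>a\<in>A. metric_trace u (b a))"
proof -
  have "metric_trace u (\<lambda>v w. \<Sum>a\<in>A. b a v w) = (\<Sum>i\<in>UNIV. \<Sum>a\<in>A. \<Sum>j\<in>UNIV. metric_inv G u $ i $ j * b a (axis i 1) (axis j 1))"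
    unfolding metric_trace_def sum_distrib_left by (intro sum.cong refl sum.swap)
  also have "\<dots> = (\<Sum>a\<in>A. metric_trace u (b a))" unfolding metric_trace_def by (rule sum.swap)
  finally show ?thesis .
qed

lemma metric_trace_scale: "metric_trace u (\<lambda>v w. b v w * c) = metric_trace u b * c"
  by (simp add: metric_trace_def sum_distrib_right mult.assoc)

lemma metric_trace_neg: "metric_trace u (\<lambda>v w. - b v w) = - metric_trace u b"
  by (simp add: metric_trace_def sum_negf)

lemma laplacian_vec_0_inner:
  assumes u: "u \<in> U" and P: "smooth_on U P" and P': "\<And>u. u \<in> U \<Longrightarrow> P' u = P u"
    and 0: "laplacian_vec G P' u = 0"
  shows "metric_trace u (\<lambda>v w. (dir_deriv2 P u v w - dir_deriv P u (christoffel_vec u v w)) \<bullet> x) = 0"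
proof -
  have "metric_trace u (\<lambda>v w. (dir_deriv2 P u v w - dir_deriv P u (christoffel_vec u v w)) $ a) = 0" for a
    using laplacian_vec_eq[OF u P P', of a] 0 by simp
  then show ?thesis unfolding inner_vec_def metric_trace_sum inner_real_def metric_trace_scale by simp
qed

lemma DD\<nu>_normal:
  assumes "u \<in> U" shows "DD\<nu> u v w \<bullet> \<nu> u = - (D\<nu> u v \<bullet> D\<nu> u w)"
proof -
  have "dir_deriv (\<lambda>u. D\<nu> u w \<bullet> \<nu> u) u v = 0"
    by (subst frechet_derivative_cong_open[OF openU assms D\<nu>_tangent(1)]) auto
  then show ?thesis using assms by (simp add: dir_deriv_inner_fun inner_commute)
qed

text \<open>
  The normal and tangent components of the covariant Hessian of \<open>f \<nu>\<close>; their traces are the two biharmonic equations.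
\<close>

lemma hessian_scaled_normal:
  assumes u: "u \<in> U" and f: "smooth_on U f"
  defines "P \<equiv> \<lambda>u. f u *\<^sub>R \<nu> u"
  shows "(dir_deriv2 P u v w - dir_deriv P u (christoffel_vec u v w)) \<bullet> \<nu> u =
      (dir_deriv2 f u v w - dir_deriv f u (christoffel_vec u v w)) - f u * (D\<nu> u v \<bullet> D\<nu> u w)"
    and "(dir_deriv2 P u v w - dir_deriv P u (christoffel_vec u v w)) \<bullet> DF u t =
      - (f u * nabla_sff u v w t + dir_deriv f u v * sff u w t + dir_deriv f u w * sff u v t)"
proof -
  have df: "f differentiable (at u)" "(\<lambda>u. dir_deriv f u w) differentiable (at u)" if "u \<in> U" for u w
    using that f smooth_on_imp_differentiable smooth_on_dir_deriv by blast+
  have 1: "dir_deriv P u w = f u *\<^sub>R D\<nu> u w + dir_deriv f u w *\<^sub>R \<nu> u" if "u \<in> U" for u w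
    unfolding P_def using that by (simp add: dir_deriv_scaleR_fun df)
  have "dir_deriv2 P u v w = dir_deriv (\<lambda>u. f u *\<^sub>R D\<nu> u w + dir_deriv f u w *\<^sub>R \<nu> u) u v"
    by (subst frechet_derivative_cong_open[OF openU u 1]) auto
  also have "\<dots> = (f u *\<^sub>R DD\<nu> u v w + dir_deriv f u v *\<^sub>R D\<nu> u w)
      + (dir_deriv f u w *\<^sub>R D\<nu> u v + dir_deriv2 f u v w *\<^sub>R \<nu> u)"
    using u by (subst dir_deriv_add_fun) (auto intro: differentiable_scaleR df simp: dir_deriv_scaleR_fun df)
  finally have 2: "dir_deriv2 P u v w = (f u *\<^sub>R DD\<nu> u v w + dir_deriv f u v *\<^sub>R D\<nu> u w)
      + (dir_deriv f u w *\<^sub>R D\<nu> u v + dir_deriv2 f u v w *\<^sub>R \<nu> u)" .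
  show "(dir_deriv2 P u v w - dir_deriv P u (christoffel_vec u v w)) \<bullet> \<nu> u =
      (dir_deriv2 f u v w - dir_deriv f u (christoffel_vec u v w)) - f u * (D\<nu> u v \<bullet> D\<nu> u w)"
    by (simp add: 1[OF u] 2 inner_diff_left inner_add_left D\<nu>_tangent[OF u] \<nu>_unit[OF u] DD\<nu>_normal[OF u])
  show "(dir_deriv2 P u v w - dir_deriv P u (christoffel_vec u v w)) \<bullet> DF u t =
      - (f u * nabla_sff u v w t + dir_deriv f u v * sff u w t + dir_deriv f u w * sff u v t)"
    by (simp add: 1[OF u] 2 inner_diff_left inner_add_left \<nu>_normal[OF u] nabla_sff_def sff_weingarten[OF u])
      (simp add: algebra_simps)
qed

definition grad_lam :: "real^'n \<Rightarrow> real^'n"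
  where "grad_lam u = (\<chi> k. \<Sum>l\<in>UNIV. metric_inv G u $ k $ l * dir_deriv lam u (axis l 1))"

lemma lam_differentiable [simp]:
  assumes "u \<in> U" shows "lam differentiable (at u)" "(\<lambda>u. dir_deriv lam u w) differentiable (at u)"
  using assms smooth_lam smooth_on_imp_differentiable smooth_on_dir_deriv by blast+

lemma grad_lam_inner: "u \<in> U \<Longrightarrow> DF u (grad_lam u) \<bullet> DF u w = dir_deriv lam u w"
  unfolding grad_lam_def metric_inv_sum
  by (simp add: dir_deriv_basis[of lam u w] mult.commute)

text \<open>
  The gradient of \<open>lam\<close> as a vector of the ambient Euclidean space.
\<close>

definition \<xi> :: "real^'n \<Rightarrow> real^'m" where "\<xi> u = DF u (grad_lam u)"

lemma smooth_\<xi>: "smooth_on U \<xi>"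
  unfolding \<xi>_def[abs_def] grad_lam_def
  by (intro smooth_intros openU smooth_F smooth_metric_inv smooth_lam)

lemma \<xi>_differentiable [simp]:
  assumes "u \<in> U" shows "\<xi> differentiable (at u)"
  using assms smooth_\<xi> smooth_on_imp_differentiable by blast

definition hess_lam :: "real^'n \<Rightarrow> real^'n \<Rightarrow> real^'n \<Rightarrow> real"
  where "hess_lam u v w = dir_deriv2 lam u v w - dir_deriv lam u (christoffel_vec u v w)"

lemma \<xi>_inner: "u \<in> U \<Longrightarrow> \<xi> u \<bullet> DF u w = dir_deriv lam u w" "u \<in> U \<Longrightarrow> \<xi> u \<bullet> \<nu> u = 0"
   "u \<in> U \<Longrightarrow> \<xi> u \<bullet> D\<nu> u v = - sff u v (grad_lam u)"
   "u \<in> U \<Longrightarrow> \<xi> u \<bullet> \<xi> u = dir_deriv lam u (grad_lam u)"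
  using \<nu>_normal[of u "grad_lam u"]
  by (simp_all add: \<xi>_def grad_lam_inner sff_weingarten inner_commute[of _ "\<nu> u"] inner_commute[of _ "D\<nu> u v"])

lemma hess_lam_sym: "u \<in> U \<Longrightarrow> hess_lam u v w = hess_lam u w v"
  unfolding hess_lam_def using dir_deriv2_commute[OF openU smooth_lam] christoffel_vec_sym by metis

lemma linear_christoffel_vec_left: "linear (\<lambda>v. christoffel_vec u v w)"
  by (rule linearI) (simp_all add: christoffel_vec_def vec_eq_iff sum.distrib distrib_left distrib_right sum_distrib_left mult_ac)

lemma bilinear_hess_lam: "u \<in> U \<Longrightarrow> bilinear (hess_lam u)"
  unfolding bilinear_def hess_lam_def
  by (auto intro!: linearI simp: dir_deriv2_linear[OF openU smooth_lam] linear_add[OF linear_christoffel_vec] linear_cmul[OF linear_christoffel_vec]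
      linear_add[OF linear_christoffel_vec_left] linear_cmul[OF linear_christoffel_vec_left] algebra_simps)

lemma D\<xi>_inner_DF:
  assumes u: "u \<in> U" shows "dir_deriv \<xi> u v \<bullet> DF u w = hess_lam u v w"
proof -
  have "dir_deriv (\<lambda>u. \<xi> u \<bullet> DF u w) u v = dir_deriv2 lam u v w"
    by (subst frechet_derivative_cong_open[OF openU u \<xi>_inner(1)]) auto
  then have "\<xi> u \<bullet> DDF u v w + dir_deriv \<xi> u v \<bullet> DF u w = dir_deriv2 lam u v w"
    using u by (simp add: dir_deriv_inner_fun)
  then show ?thesis
    using u by (simp add: gauss_formula[where v=v and w=w] inner_add_right \<xi>_inner hess_lam_def)
qed

lemma D\<xi>_normal:
  assumes u: "u \<in> U" shows "dir_deriv \<xi> u v \<bullet> \<nu> u = sff u v (grad_lam u)"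
proof -
  have "dir_deriv (\<lambda>u. \<xi> u \<bullet> \<nu> u) u v = 0"
    by (subst frechet_derivative_cong_open[OF openU u \<xi>_inner(2)]) auto
  then show ?thesis using u by (simp add: dir_deriv_inner_fun \<xi>_inner)
qed

lemma D\<nu>_norm_frame:
  assumes u: "u \<in> U" and E: "surj E" "\<And>v w. DF u (E v) \<bullet> DF u (E w) = v \<bullet> w"
  shows "D\<nu> u v \<bullet> D\<nu> u v = (\<Sum>c\<in>Basis. (sff u v (E c))\<^sup>2)"
proof -
  obtain w where w: "shape u v = E w" using E(1) by (metis surjD)
  have "D\<nu> u v \<bullet> D\<nu> u v = w \<bullet> w"
    using E(2)[of w w] DF_shape[OF u, of v] by (simp add: w)
  moreover have "w \<bullet> c = sff u v (E c)" for c
    using E(2)[of w c] DF_shape_inner[OF u, of v "E c"] by (simp add: w)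
  ultimately show ?thesis using sum_Basis_inner[of w w] by (simp add: power2_eq_square)
qed

end

text \<open>
  The map \<open>P\<close> is the mean curvature vector field; \<open>k\<close> is the factor between \<open>lam\<close> and the mean curvature.
\<close>

locale biharmonic_recurrent_patch = hypersurface_patch U F \<nu> G
  for U :: "(real^'n::finite) set" and F \<nu> :: "real^'n \<Rightarrow> real^'m::finite" and G +
  fixes P :: "real^'n \<Rightarrow> real^'m" and k :: real and \<eta> :: "real^'n \<Rightarrow> real^'n \<Rightarrow> real"
  assumes k: "k \<noteq> 0"
    and P: "u \<in> U \<Longrightarrow> P u = (k * lam u) *\<^sub>R \<nu> u"
    and biharmonic: "u \<in> U \<Longrightarrow> laplacian_vec G P u = 0"
    and recurrent: "u \<in> U \<Longrightarrow> cov_curvature G (\<lambda>_. a) (\<lambda>_. y) (\<lambda>_. z) (\<lambda>_. w) u =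
       \<eta> u a *\<^sub>R curvature G (\<lambda>_. y) (\<lambda>_. z) (\<lambda>_. w) u"
begin

text \<open>
  The normal part of \<open>\<Delta>(H \<nu>) = 0\<close> is the first equation.  In the tangent part the trace of the covariant
  derivative of the second fundamental form is, by Codazzi, the derivative of its trace; hence the gradient
  of \<open>lam\<close> is a principal direction.
\<close>

lemma biharmonic_frame:
  assumes u: "u \<in> U" and E: "surj E" "\<And>v w. DF u (E v) \<bullet> DF u (E w) = v \<bullet> w"
    "\<And>b. bilinear b \<Longrightarrow> metric_trace u b = (\<Sum>c\<in>Basis. b (E c) (E c))"
  shows "(\<Sum>c\<in>Basis. hess_lam u (E c) (E c)) = lam u * (\<Sum>c\<in>Basis. \<Sum>d\<in>Basis. (sff u (E c) (E d))\<^sup>2)"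
    and "sff u (grad_lam u) t = lam u * dir_deriv lam u t"
proof -
  let ?f = "\<lambda>u. k * lam u" and ?P = "\<lambda>u. (k * lam u) *\<^sub>R \<nu> u"
  have f: "smooth_on U ?f" by (intro smooth_intros openU smooth_lam)
  have sP: "smooth_on U ?P" by (intro smooth_intros openU smooth_lam smooth_\<nu>)
  have Df: "dir_deriv ?f u w = k * dir_deriv lam u w" if "u \<in> U" for u w
    using that by (simp add: dir_deriv_mult_fun)
  have DDf: "dir_deriv2 ?f u v w = k * dir_deriv2 lam u v w" for v w
    by (subst frechet_derivative_cong_open[OF openU u Df]) (simp_all add: dir_deriv_mult_fun u)
  note lap = laplacian_vec_0_inner[OF u sP P biharmonic[OF u]]
  have "metric_trace u (\<lambda>v w. k * hess_lam u v w - k * lam u * (D\<nu> u v \<bullet> D\<nu> u w)) = 0"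
    using lap[of "\<nu> u"] unfolding hessian_scaled_normal[OF u f]
    by (simp add: DDf Df u hess_lam_def right_diff_distrib)
  also have "metric_trace u (\<lambda>v w. k * hess_lam u v w - k * lam u * (D\<nu> u v \<bullet> D\<nu> u w)) =
     (\<Sum>c\<in>Basis. k * hess_lam u (E c) (E c) - k * lam u * (D\<nu> u (E c) \<bullet> D\<nu> u (E c)))"
  proof (rule E(3))
    show "bilinear (\<lambda>v w. k * hess_lam u v w - k * lam u * (D\<nu> u v \<bullet> D\<nu> u w))"
      unfolding bilinear_def using bilinear_hess_lam[OF u] u
      by (auto intro!: linearI simp: bilinear_ladd bilinear_radd bilinear_lmul bilinear_rmul
          inner_add_left inner_add_right algebra_simps)
  qed
  finally have "k * ((\<Sum>c\<in>Basis. hess_lam u (E c) (E c)) - lam u * (\<Sum>c\<in>Basis. D\<nu> u (E c) \<bullet> D\<nu> u (E c))) = 0"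
    by (simp add: sum_subtractf sum_distrib_left right_diff_distrib mult.assoc)
  then show "(\<Sum>c\<in>Basis. hess_lam u (E c) (E c)) = lam u * (\<Sum>c\<in>Basis. \<Sum>d\<in>Basis. (sff u (E c) (E d))\<^sup>2)"
    using k unfolding D\<nu>_norm_frame[OF u E(1,2)] by simp
  have b_sff: "sff u (x + y) t = sff u x t + sff u y t" "sff u (c *\<^sub>R x) t = c * sff u x t" for x y c
    using bilinear_sff[OF u] by (simp_all add: bilinear_ladd bilinear_lmul)
  let ?b = "\<lambda>v w. k * lam u * nabla_sff u v w t + k * dir_deriv lam u v * sff u w t + k * dir_deriv lam u w * sff u v t"
  have "metric_trace u (\<lambda>v w. - ?b v w) = 0"
    using lap[of "DF u t"] unfolding hessian_scaled_normal[OF u f] Df[OF u] .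
  then have "metric_trace u ?b = 0" unfolding metric_trace_neg by simp
  also have "metric_trace u ?b = (\<Sum>c\<in>Basis. ?b (E c) (E c))"
  proof (rule E(3))
    show "bilinear ?b"
      unfolding bilinear_def using bilinear_nabla_sff[OF u] u nabla_sff_sym12[OF u]
      by (auto intro!: linearI simp: bilinear_ladd bilinear_radd bilinear_lmul bilinear_rmul b_sff algebra_simps)
  qed
  finally have "k * (lam u * (\<Sum>c\<in>Basis. nabla_sff u (E c) (E c) t)
     + 2 * (\<Sum>c\<in>Basis. dir_deriv lam u (E c) * sff u (E c) t)) = 0"
    by (simp add: sum.distrib sum_distrib_left distrib_left mult_ac)
  then have "lam u * (\<Sum>c\<in>Basis. nabla_sff u (E c) (E c) t)
     + 2 * (\<Sum>c\<in>Basis. dir_deriv lam u (E c) * sff u (E c) t) = 0" using k by simp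
  moreover have "(\<Sum>c\<in>Basis. nabla_sff u (E c) (E c) t) = - 2 * dir_deriv lam u t"
  proof -
    have "nabla_sff u (E c) (E c) t = nabla_sff u t (E c) (E c)" for c
      using nabla_sff_sym12[OF u] nabla_sff_sym23[OF u] by metis
    then show ?thesis using metric_trace_nabla_sff[OF u, of t] E(3)[OF bilinear_nabla_sff[OF u]] by simp
  qed
  moreover have "(\<Sum>c\<in>Basis. dir_deriv lam u (E c) * sff u (E c) t) = sff u (grad_lam u) t"
  proof -
    obtain X where X: "grad_lam u = E X" using E(1) by (metis surjD)
    have "dir_deriv lam u (E c) = X \<bullet> c" for c
      using grad_lam_inner[OF u, of "E c"] E(2)[of X c] by (simp add: X)
    moreover obtain s where s: "shape u t = E s" using E(1) by (metis surjD)
    have "sff u (E c) t = s \<bullet> c" for c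
      using DF_shape_inner[OF u, of t "E c"] E(2)[of s c] sff_sym[OF u, of t "E c"] by (simp add: s)
    ultimately show ?thesis using sum_Basis_inner[of X s] by (simp add: X inner_commute)
  qed
  ultimately show "sff u (grad_lam u) t = lam u * dir_deriv lam u t" by simp
qed

lemma principal:
  assumes "u \<in> U" shows "sff u (grad_lam u) t = lam u * dir_deriv lam u t" "sff u t (grad_lam u) = lam u * dir_deriv lam u t"
proof -
  show "sff u (grad_lam u) t = lam u * dir_deriv lam u t"
    by (rule orthonormal_frame[OF assms]) (rule biharmonic_frame[OF assms])
  then show "sff u t (grad_lam u) = lam u * dir_deriv lam u t" using sff_sym[OF assms] by simp
qed

text \<open>
  The derivative of \<open>\<xi> \<bullet> D\<nu> u w = - lam u * dir_deriv lam u w\<close>, which is the principal direction equation in ambient form.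
\<close>

lemma D_principal:
  assumes u: "u \<in> U"
  shows "nabla_sff u v w (grad_lam u) - dir_deriv \<xi> u v \<bullet> D\<nu> u w =
    dir_deriv lam u v * dir_deriv lam u w + lam u * hess_lam u v w"
proof -
  have *: "\<xi> u \<bullet> D\<nu> u w = - (lam u * dir_deriv lam u w)" if "u \<in> U" for u
    using that by (simp add: \<xi>_inner principal)
  have "dir_deriv (\<lambda>u. \<xi> u \<bullet> D\<nu> u w) u v = dir_deriv (\<lambda>u. - (lam u * dir_deriv lam u w)) u v"
    by (subst frechet_derivative_cong_open[OF openU u *]) auto
  then have 1: "\<xi> u \<bullet> DD\<nu> u v w + dir_deriv \<xi> u v \<bullet> D\<nu> u w =
      - (lam u * dir_deriv2 lam u v w + dir_deriv lam u v * dir_deriv lam u w)"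
    using u by (simp add: dir_deriv_inner_fun dir_deriv_mult_fun dir_deriv_minus_fun differentiable_mult)
  have "\<xi> u \<bullet> DD\<nu> u v w = - nabla_sff u v w (grad_lam u) + \<xi> u \<bullet> D\<nu> u (christoffel_vec u v w)"
    by (simp add: nabla_sff_def \<xi>_def inner_diff_left inner_diff_right inner_commute)
  then show ?thesis using 1 u by (simp add: \<xi>_inner principal hess_lam_def algebra_simps)
qed

lemma hess_lam_eq:
  assumes u: "u \<in> U" and nz: "lam u \<noteq> 0" "\<xi> u \<noteq> 0"
  shows "hess_lam u v w = (10 * lam u ^ 3 / (\<xi> u \<bullet> \<xi> u) + 1 / (2 * lam u)) * (dir_deriv lam u v * dir_deriv lam u w)
      + (\<xi> u \<bullet> \<xi> u) / (4 * (lam u)\<^sup>2) * sff u v w"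
    and "\<exists>e. dir_deriv lam u e = 0 \<and> sff u e e \<noteq> 0"
proof -
  obtain E :: "real^'n \<Rightarrow> real^'n" where linE: "linear E" and E: "surj E" "\<And>v w. DF u (E v) \<bullet> DF u (E w) = v \<bullet> w"
    "\<And>b. bilinear b \<Longrightarrow> metric_trace u b = (\<Sum>c\<in>Basis. b (E c) (E c))"
    using orthonormal_frame[OF u] by blast
  obtain X where X: "grad_lam u = E X" using E(1) by (metis surjD)
  have DE: "dir_deriv lam u (E w) = X \<bullet> w" for w
    using grad_lam_inner[OF u, of "E w"] E(2)[of X w] by (simp add: X)
  have \<phi>: "\<xi> u \<bullet> \<xi> u = X \<bullet> X" by (simp add: \<xi>_def X E(2))
  have X0: "X \<noteq> 0" using nz(2) linear_0[OF linE] DF_eq_0[OF u, of 0] by (auto simp: \<xi>_def X)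
  define S where "S v = (\<Sum>c\<in>Basis. hess_lam u (E v) (E c) *\<^sub>R c)" for v
  have bilE: "bilinear (\<lambda>v w. b (E v) (E w))" if "bilinear b" for b :: "real^'n \<Rightarrow> real^'n \<Rightarrow> real"
    using bilinear_ladd[OF that] bilinear_radd[OF that] bilinear_lmul[OF that] bilinear_rmul[OF that]
    unfolding bilinear_def by (auto intro!: linearI simp: linear_add[OF linE] linear_cmul[OF linE])
  have S: "S v \<bullet> w = hess_lam u (E v) (E w)" for v w
  proof -
    have l: "linear (\<lambda>w. hess_lam u (E v) (E w))"
      using bilE[OF bilinear_hess_lam[OF u]] by (simp add: bilinear_def)
    have "hess_lam u (E v) (E w) = hess_lam u (E v) (E (\<Sum>c\<in>Basis. (w \<bullet> c) *\<^sub>R c))"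
      by (simp add: euclidean_representation)
    also have "\<dots> = (\<Sum>c\<in>Basis. (w \<bullet> c) * hess_lam u (E v) (E c))"
      by (simp add: linear_sum[OF l] linear_cmul[OF l] del: euclidean_representation)
    also have "\<dots> = S v \<bullet> w"
      unfolding S_def inner_sum_left inner_scaleR_left by (simp add: inner_commute mult.commute)
    finally show ?thesis by simp
  qed
  have DS: "dir_deriv \<xi> u (E v) = DF u (E (S v)) + (dir_deriv \<xi> u (E v) \<bullet> \<nu> u) *\<^sub>R \<nu> u" for v
  proof (rule ambient_eqI[OF u])
    fix w
    obtain w' where w': "w = E w'" using E(1) by (metis surjD)
    show "dir_deriv \<xi> u (E v) \<bullet> DF u w = (DF u (E (S v)) + (dir_deriv \<xi> u (E v) \<bullet> \<nu> u) *\<^sub>R \<nu> u) \<bullet> DF u w"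
      by (simp add: inner_add_left \<nu>_normal[OF u] w' E(2) S D\<xi>_inner_DF[OF u])
  next
    show "dir_deriv \<xi> u (E v) \<bullet> \<nu> u = (DF u (E (S v)) + (dir_deriv \<xi> u (E v) \<bullet> \<nu> u) *\<^sub>R \<nu> u) \<bullet> \<nu> u"
      using \<nu>_normal[OF u, of "E (S v)"] by (simp add: inner_add_left \<nu>_unit[OF u] inner_commute[of "DF u _"])
  qed
  have hS: "sff u (E (S v)) (E w) = - (dir_deriv \<xi> u (E v) \<bullet> D\<nu> u (E w))" for v w
  proof -
    have "dir_deriv \<xi> u (E v) \<bullet> D\<nu> u (E w) = DF u (E (S v)) \<bullet> D\<nu> u (E w)"
      by (subst DS) (simp add: inner_add_left D\<nu>_tangent[OF u])
    then show ?thesis using sff_sym[OF u, of "E (S v)" "E w"] by (simp add: sff_weingarten[OF u] inner_commute)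
  qed
  have rec: "nabla_sff u a z w * sff u y t + sff u z w * nabla_sff u a y t
    - nabla_sff u a y w * sff u z t - sff u y w * nabla_sff u a z t
    = \<eta> u a * (sff u z w * sff u y t - sff u y w * sff u z t)" for a y z w t
  proof -
    have "DF u (curvature G (\<lambda>_. y) (\<lambda>_. z) (\<lambda>_. w) u) \<bullet> DF u t = sff u z w * sff u y t - sff u y w * sff u z t"
      using gauss_equation[OF u smooth_on_const smooth_on_const smooth_on_const, of y z w]
      by (simp add: inner_diff_left sff_weingarten[OF u])
    then show ?thesis
      unfolding cov_curvature_eq[OF u, symmetric] recurrent[OF u] using u by simp
  qed
  have f1: "nabla_sff u (E v) (E X) (E w) + sff u (E (S v)) (E w) = (X \<bullet> v) * (X \<bullet> w) + lam u * hess_lam u (E v) (E w)" for v w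
    using D_principal[OF u, of "E v" "E w"] hS nabla_sff_sym23[OF u, of "E v" "E X" "E w"]
    by (simp add: DE X)
  have f2: "sff u (E X) (E w) = lam u * (X \<bullet> w)" for w
    using principal(1)[OF u, of "E w"] by (simp add: X DE)
  have f3: "(\<Sum>c\<in>Basis. sff u (E c) (E c)) = - 2 * lam u"
    using E(3)[OF bilinear_sff[OF u]] metric_trace_sff[OF u] by simp
  have f4: "(\<Sum>c\<in>Basis. nabla_sff u (E v) (E c) (E c)) = - 2 * (X \<bullet> v)" for v
    using E(3)[OF bilinear_nabla_sff[OF u]] metric_trace_nabla_sff[OF u, of "E v"] by (simp add: DE)
  have f5: "(nabla_sff u (E v) (E y) (E w) - \<eta> u (E v) / 2 * sff u (E y) (E w)) * sff u (E z) (E t) +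
       sff u (E y) (E w) * (nabla_sff u (E v) (E z) (E t) - \<eta> u (E v) / 2 * sff u (E z) (E t)) -
       (nabla_sff u (E v) (E y) (E t) - \<eta> u (E v) / 2 * sff u (E y) (E t)) * sff u (E z) (E w) -
       sff u (E y) (E t) * (nabla_sff u (E v) (E z) (E w) - \<eta> u (E v) / 2 * sff u (E z) (E w)) = 0" for v y w z t
    using rec[where a = "E v" and y = "E y" and z = "E z" and w = "E w" and t = "E t"] by (simp add: algebra_simps)
  note alg = hessian_from_shape[where h = "\<lambda>v w. sff u (E v) (E w)" and \<sigma> = "\<lambda>v w. hess_lam u (E v) (E w)"
      and \<tau> = "\<lambda>v y w. nabla_sff u (E v) (E y) (E w)" and S = S and \<eta> = "\<lambda>v. \<eta> u (E v) / 2",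
      OF bilE[OF bilinear_sff[OF u]] sff_sym[OF u] bilE[OF bilinear_nabla_sff[OF u]] nabla_sff_sym12[OF u]
        nabla_sff_sym23[OF u] hess_lam_sym[OF u] S X0 nz(1) f2 f3 f4 biharmonic_frame(1)[OF u E] f1 f5]
  obtain v' w' where vw: "v = E v'" "w = E w'" using E(1) by (metis surjD)
  show "hess_lam u v w = (10 * lam u ^ 3 / (\<xi> u \<bullet> \<xi> u) + 1 / (2 * lam u)) * (dir_deriv lam u v * dir_deriv lam u w)
      + (\<xi> u \<bullet> \<xi> u) / (4 * (lam u)\<^sup>2) * sff u v w"
    unfolding \<phi> vw DE by (rule alg(1))
  from alg(2) obtain e where "X \<bullet> e = 0" "sff u (E e) (E e) \<noteq> 0" by blast
  then show "\<exists>e. dir_deriv lam u e = 0 \<and> sff u e e \<noteq> 0" using DE by metis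
qed

text \<open>
  On the open set where \<open>lam\<close> and \<open>\<xi>\<close> do not vanish, the formula for the Hessian is a closed first-order
  system for \<open>\<xi>\<close>.  Its integrability condition, tested on the gradient and on a direction \<open>e\<close> orthogonal to it
  with \<open>sff u e e \<noteq> 0\<close>, determines the length of the gradient, and this is inconsistent with the system.
\<close>

lemma gradient_eq_0:
  assumes "u \<in> U" "lam u \<noteq> 0"
  shows "\<xi> u = 0"
proof (rule ccontr)
  assume "\<xi> u \<noteq> 0"
  define V where "V = {u \<in> U. lam u \<noteq> 0 \<and> \<xi> u \<noteq> 0}"
  have uV: "u \<in> V" using assms \<open>\<xi> u \<noteq> 0\<close> by (simp add: V_def)
  have VU: "V \<subseteq> U" and V: "\<And>u. u \<in> V \<Longrightarrow> u \<in> U" "\<And>u. u \<in> V \<Longrightarrow> lam u \<noteq> 0" "\<And>u. u \<in> V \<Longrightarrow> \<xi> u \<noteq> 0"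
    by (auto simp: V_def)
  have "open ((U \<inter> lam -` (- {0})) \<inter> (U \<inter> \<xi> -` (- {0})))"
    by (intro open_Int continuous_open_preimage smooth_on_imp_continuous_on smooth_lam smooth_\<xi> openU) auto
  also have "(U \<inter> lam -` (- {0})) \<inter> (U \<inter> \<xi> -` (- {0})) = V" by (auto simp: V_def)
  finally have openV: "open V" .
  define \<phi> where "\<phi> u = \<xi> u \<bullet> \<xi> u" for u
  define \<alpha> where "\<alpha> u = 10 * lam u ^ 3 / \<phi> u + 1 / (2 * lam u)" for u
  define \<beta> where "\<beta> u = \<phi> u / (4 * (lam u)\<^sup>2)" for u
  define \<kappa> where "\<kappa> u = \<alpha> u *\<^sub>R \<xi> u + lam u *\<^sub>R \<nu> u" for u
  have \<phi>pos: "\<phi> u > 0" if "u \<in> V" for u using V(3)[OF that] by (simp add: \<phi>_def)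
  note smV = smooth_on_subset[OF _ VU]
  have s\<phi>: "smooth_on V \<phi>" unfolding \<phi>_def[abs_def] by (intro smooth_intros openV smV smooth_\<xi>)
  have s\<alpha>: "smooth_on V \<alpha>" unfolding \<alpha>_def[abs_def]
    by (intro smooth_intros openV smV[OF smooth_lam] s\<phi>) (use \<phi>pos V in \<open>auto dest!: \<phi>pos\<close>)
  have s\<beta>: "smooth_on V \<beta>" unfolding \<beta>_def[abs_def]
    by (intro smooth_intros openV smV[OF smooth_lam] s\<phi>) (use V in auto)
  have s\<kappa>: "smooth_on V \<kappa>" unfolding \<kappa>_def[abs_def]
    by (intro smooth_intros openV smV smooth_\<xi> smooth_\<nu> smooth_lam s\<alpha>)
  note diff = smooth_on_imp_differentiable[OF s\<phi>] smooth_on_imp_differentiable[OF s\<alpha>]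
    smooth_on_imp_differentiable[OF s\<beta>] smooth_on_imp_differentiable[OF s\<kappa>]
  have D\<xi>: "dir_deriv \<xi> u w = dir_deriv lam u w *\<^sub>R \<kappa> u - \<beta> u *\<^sub>R D\<nu> u w" if "u \<in> V" for u w
  proof (rule ambient_eqI[OF V(1)[OF that]])
    note u = V(1)[OF that]
    show "dir_deriv \<xi> u w \<bullet> DF u t = (dir_deriv lam u w *\<^sub>R \<kappa> u - \<beta> u *\<^sub>R D\<nu> u w) \<bullet> DF u t" for t
      by (simp add: D\<xi>_inner_DF[OF u] hess_lam_eq(1)[OF u V(2,3)[OF that]] \<kappa>_def inner_diff_left inner_add_left
          \<xi>_inner[OF u] \<nu>_normal[OF u] sff_weingarten[OF u] \<alpha>_def \<beta>_def \<phi>_def)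
    show "dir_deriv \<xi> u w \<bullet> \<nu> u = (dir_deriv lam u w *\<^sub>R \<kappa> u - \<beta> u *\<^sub>R D\<nu> u w) \<bullet> \<nu> u"
      by (simp add: D\<xi>_normal[OF u] principal[OF u] \<kappa>_def inner_diff_left inner_add_left \<xi>_inner[OF u]
          \<nu>_unit[OF u] D\<nu>_tangent[OF u])
  qed
  have D\<phi>: "dir_deriv \<phi> u (grad_lam u) = 2 * (\<alpha> u * (\<phi> u)\<^sup>2 + \<beta> u * (lam u * \<phi> u))"
    and Dlam: "dir_deriv lam u (grad_lam u) = \<phi> u" if "u \<in> V" for u
  proof -
    note u = V(1)[OF that]
    show Dlam: "dir_deriv lam u (grad_lam u) = \<phi> u" by (simp add: \<phi>_def \<xi>_inner[OF u])
    have "dir_deriv \<phi> u (grad_lam u) = 2 * (dir_deriv \<xi> u (grad_lam u) \<bullet> \<xi> u)"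
      unfolding \<phi>_def[abs_def] using u by (simp add: dir_deriv_inner_fun inner_commute)
    also have "dir_deriv \<xi> u (grad_lam u) \<bullet> \<xi> u = hess_lam u (grad_lam u) (grad_lam u)"
      by (simp add: \<xi>_def D\<xi>_inner_DF[OF u])
    also have "\<dots> = \<alpha> u * (\<phi> u)\<^sup>2 + \<beta> u * (lam u * \<phi> u)"
      unfolding hess_lam_eq(1)[OF u V(2,3)[OF that]] \<alpha>_def \<beta>_def Dlam principal[OF u]
      by (simp add: \<phi>_def power2_eq_square)
    finally show "dir_deriv \<phi> u (grad_lam u) = 2 * (\<alpha> u * (\<phi> u)\<^sup>2 + \<beta> u * (lam u * \<phi> u))" .
  qed
  have \<phi>14: "\<phi> u = 14 * lam u ^ 4" if uV: "u \<in> V" for u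
  proof -
    note u = V(1)[OF uV]
    obtain e where e: "dir_deriv lam u e = 0" "sff u e e \<noteq> 0"
      using hess_lam_eq(2)[OF u V(2,3)[OF uV]] by blast
    let ?X = "grad_lam u"
    have DD: "dir_deriv2 \<xi> u v w = (dir_deriv lam u w *\<^sub>R dir_deriv \<kappa> u v + dir_deriv2 lam u v w *\<^sub>R \<kappa> u)
       - (\<beta> u *\<^sub>R DD\<nu> u v w + dir_deriv \<beta> u v *\<^sub>R D\<nu> u w)" for v w
    proof -
      have "dir_deriv2 \<xi> u v w = dir_deriv (\<lambda>u. dir_deriv lam u w *\<^sub>R \<kappa> u - \<beta> u *\<^sub>R D\<nu> u w) u v"
        by (subst frechet_derivative_cong_open[OF openV uV D\<xi>]) auto
      then show ?thesis using u diff[OF uV]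
        by (simp add: dir_deriv_diff_fun differentiable_scaleR dir_deriv_scaleR_fun)
    qed
    have D\<kappa>: "dir_deriv \<kappa> u e \<bullet> DF u e = (\<alpha> u * \<beta> u - lam u) * sff u e e"
    proof -
      have "dir_deriv \<kappa> u e = (\<alpha> u *\<^sub>R dir_deriv \<xi> u e + dir_deriv \<alpha> u e *\<^sub>R \<xi> u)
         + (lam u *\<^sub>R D\<nu> u e + dir_deriv lam u e *\<^sub>R \<nu> u)"
        unfolding \<kappa>_def[abs_def] using u diff[OF uV]
        by (simp add: dir_deriv_add_fun differentiable_scaleR dir_deriv_scaleR_fun)
      note D\<kappa>' = this
      show ?thesis unfolding D\<kappa>'
        by (simp add: D\<xi>[OF uV] e inner_add_left \<xi>_inner[OF u] \<nu>_normal[OF u] sff_weingarten[OF u] algebra_simps)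
    qed
    \<comment> \<open>The integrability condition.\<close>
    have "dir_deriv2 \<xi> u ?X e \<bullet> DF u e = dir_deriv2 \<xi> u e ?X \<bullet> DF u e"
      using dir_deriv2_commute[OF openU smooth_\<xi> u] by simp
    then have "dir_deriv \<beta> u ?X * sff u e e = \<phi> u * (dir_deriv \<kappa> u e \<bullet> DF u e) + dir_deriv \<beta> u e * sff u ?X e"
      using DD\<nu>_commute[OF u, of ?X e] dir_deriv2_commute[OF openU smooth_lam u, of ?X e]
      unfolding DD by (simp add: e Dlam[OF uV] inner_diff_left inner_add_left sff_weingarten[OF u])
    then have "dir_deriv \<beta> u ?X * sff u e e = \<phi> u * (\<alpha> u * \<beta> u - lam u) * sff u e e"
      by (simp add: D\<kappa> principal[OF u] e)
    then have B: "dir_deriv \<beta> u ?X = \<phi> u * (\<alpha> u * \<beta> u - lam u)" using e(2) by simp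
    have "\<beta> u * (4 * (lam u * lam u)) = \<phi> u" if "u \<in> V" for u using V(2)[OF that] by (simp add: \<beta>_def power2_eq_square)
    then have "dir_deriv (\<lambda>u. \<beta> u * (4 * (lam u * lam u))) u ?X = dir_deriv \<phi> u ?X"
      by (subst frechet_derivative_cong_open[OF openV uV]) auto
    also have "dir_deriv (\<lambda>u. \<beta> u * (4 * (lam u * lam u))) u ?X
       = dir_deriv \<beta> u ?X * (4 * (lam u)\<^sup>2) + \<beta> u * (8 * lam u * \<phi> u)"
      using u diff[OF uV] Dlam[OF uV] by (simp add: dir_deriv_mult_fun differentiable_mult power2_eq_square algebra_simps)
    finally show ?thesis
      using gradient_norm_determined[OF V(2)[OF uV] \<phi>pos[OF uV] \<alpha>_def \<beta>_def _ B] unfolding D\<phi>[OF uV] by simp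
  qed
  let ?X = "grad_lam u"
  have "dir_deriv \<phi> u ?X = dir_deriv (\<lambda>u. 14 * ((lam u * lam u) * (lam u * lam u))) u ?X"
    by (subst frechet_derivative_cong_open[OF openV uV \<phi>14]) (auto simp: power4_eq_xxxx mult.assoc)
  also have "\<dots> = 56 * lam u ^ 3 * \<phi> u"
    using assms(1) Dlam[OF uV] by (simp add: dir_deriv_mult_fun differentiable_mult power3_eq_cube algebra_simps)
  finally show False
    using gradient_norm_contradiction[OF V(2)[OF uV] \<phi>pos[OF uV] \<alpha>_def \<beta>_def \<phi>14[OF uV]] unfolding D\<phi>[OF uV] by simp
qed

text \<open>
  Near a point with \<open>lam u \<noteq> 0\<close> the gradient vanishes, hence so does the Hessian, and the normal biharmonic equation
  forces the second fundamental form to be zero.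
\<close>

theorem half_trace_shape_eq_0:
  assumes u: "u \<in> U"
  shows "lam u = 0"
proof (rule ccontr)
  assume nz: "lam u \<noteq> 0"
  define V where "V = {u \<in> U. lam u \<noteq> 0}"
  have "open (U \<inter> lam -` (- {0}))"
    by (intro continuous_open_preimage smooth_on_imp_continuous_on smooth_lam openU) auto
  also have "U \<inter> lam -` (- {0}) = V" by (auto simp: V_def)
  finally have openV: "open V" .
  have uV: "u \<in> V" using u nz by (simp add: V_def)
  have D0: "dir_deriv lam u w = 0" if "u \<in> V" for u w
    using gradient_eq_0[of u] \<xi>_inner(1)[of u w] that by (simp add: V_def)
  have "dir_deriv2 lam u v w = 0" for v w
    by (subst frechet_derivative_cong_open[OF openV uV D0]) auto
  then have hess: "hess_lam u v w = 0" for v w using D0[OF uV] by (simp add: hess_lam_def)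
  obtain E :: "real^'n \<Rightarrow> real^'n" where "linear E" and E: "surj E" "\<And>v w. DF u (E v) \<bullet> DF u (E w) = v \<bullet> w"
    "\<And>b. bilinear b \<Longrightarrow> metric_trace u b = (\<Sum>c\<in>Basis. b (E c) (E c))"
    using orthonormal_frame[OF u] by blast
  have "(\<Sum>c\<in>Basis. \<Sum>d\<in>Basis. (sff u (E c) (E d))\<^sup>2) = 0"
    using biharmonic_frame(1)[OF u E] nz by (simp add: hess)
  then have "sff u (E c) (E c) = 0" if "c \<in> Basis" for c
    using that by (simp add: sum_nonneg_eq_0_iff sum_nonneg)
  then have "metric_trace u (sff u) = 0" using E(3)[OF bilinear_sff[OF u]] by simp
  then show False using metric_trace_sff[OF u] nz by simp
qed

end

section \<open>From patches to manifolds\<close>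

theorem theorem3p2:
  fixes M :: "'p topology"
    and \<A> :: "('p, 'n::finite) chart set"
    and g :: "('p, 'n) chart \<Rightarrow> real^'n \<Rightarrow> real^'n \<Rightarrow> real^'n \<Rightarrow> real"
    and x :: "'p \<Rightarrow> real^'m::finite"
  assumes "smooth_manifold M \<A>"
    and "riemannian_metric \<A> g"
    and "CARD('m) = CARD('n) + 1"
    and "isometric_immersion \<A> g x"
    and "biharmonic_hypersurface M \<A> g x"
    and "recurrent_curvature \<A> g"
  shows "minimal_hypersurface M \<A> x"
  unfolding minimal_hypersurface_def
proof (intro allI impI ballI)
  fix W N c u
  assume N: "local_unit_normal M \<A> x W N" and c: "c \<in> \<A>" and u: "u \<in> snd c ` (fst c \<inter> W)"
  let ?U = "snd c ` (fst c \<inter> W)" and ?F = "x \<circ> chart_inv c" and ?\<nu> = "N \<circ> chart_inv c"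
  have opens: "openin M (fst c)" "openin M W" "open (chart_image c)"
    and hom: "homeomorphic_map (subtopology M (fst c)) (top_of_set (chart_image c)) (snd c)"
    using assms(1) N c by (auto simp: smooth_manifold_def local_unit_normal_def)
  have top: "topspace (subtopology M (fst c)) = fst c"
    using openin_subset[OF opens(1)] by (auto simp: topspace_subtopology)
  have inj: "inj_on (snd c) (fst c)"
    using homeomorphic_imp_injective_map[OF hom] unfolding top .
  have inv: "chart_inv c (snd c p) = p" if "p \<in> fst c" for p
    using that inj by (simp add: chart_inv_def)
  have sub: "?U \<subseteq> chart_image c" by (auto simp: chart_image_def)
  have "openin (subtopology M (fst c)) (fst c \<inter> W)"
    using opens by (simp add: openin_subtopology_Int2)
  then have "openin (top_of_set (chart_image c)) ?U"
    using homeomorphic_imp_open_map[OF hom] by (simp add: open_map_def)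
  then have openU: "open ?U" using opens(3) openin_open_eq by blast
  have "smooth_on (snd c ` (fst c \<inter> UNIV)) ?F"
    using assms(4) c by (auto simp: isometric_immersion_def smooth_map_on_def)
  then have smF: "smooth_on ?U ?F" by (rule smooth_on_subset) auto
  have sm\<nu>: "smooth_on ?U ?\<nu>"
    using N c by (auto simp: local_unit_normal_def smooth_map_on_def)
  have imm: "inj (frechet_derivative ?F (at u))"
    "g c u v w = dir_deriv ?F u v \<bullet> dir_deriv ?F u w" if "u \<in> ?U" for u v w
    using assms(4) c that sub by (auto simp: isometric_immersion_def)
  interpret hypersurface_patch ?U ?F ?\<nu> "g c"
  proof
    fix u v assume u: "u \<in> ?U"
    then have "chart_inv c u \<in> W" using inv by auto
    then have "norm (?\<nu> u) = 1" using N by (auto simp: local_unit_normal_def)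
    then show "?\<nu> u \<bullet> ?\<nu> u = 1" by (simp add: norm_eq_1)
    show "?\<nu> u \<bullet> dir_deriv ?F u v = 0" using N c u by (auto simp: local_unit_normal_def)
  qed (use openU smF sm\<nu> imm assms(3) in auto)
  have shape_op: "shape_operator c x N u = shape u" if "u \<in> ?U" for u
    using DF_shape[OF that] inv_f_f[OF imm(1)[OF that]]
    by (auto simp: fun_eq_iff shape_operator_def) (metis (no_types))
  have mean: "mean_curvature c x N u = - (2 / real CARD('n)) * lam u" if "u \<in> ?U" for u
    by (simp add: mean_curvature_def shape_op[OF that] trace_def matrix_def lam_def)
  obtain \<eta> where \<eta>: "\<And>X Y Z W u. smooth_on (chart_image c) X \<Longrightarrow> smooth_on (chart_image c) Y \<Longrightarrow>
         smooth_on (chart_image c) Z \<Longrightarrow> smooth_on (chart_image c) W \<Longrightarrow> u \<in> chart_image c \<Longrightarrow>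
         cov_curvature (g c) X Y Z W u = \<eta> c u (X u) *\<^sub>R curvature (g c) Y Z W u"
    using assms(6) c unfolding recurrent_curvature_def by metis
  interpret biharmonic_recurrent_patch ?U ?F ?\<nu> "g c" "mean_curvature_vector c x N" "- (2 / real CARD('n))" "\<eta> c"
  proof
    show "- (2 / real CARD('n)) \<noteq> 0" by simp
    fix u assume u: "u \<in> ?U"
    show "mean_curvature_vector c x N u = (- (2 / real CARD('n)) * lam u) *\<^sub>R ?\<nu> u"
      using mean[OF u] by (simp add: mean_curvature_vector_def)
    show "laplacian_vec (g c) (mean_curvature_vector c x N) u = 0"
      using assms(5) N c u by (auto simp: biharmonic_hypersurface_def)
    fix a y z w
    show "cov_curvature (g c) (\<lambda>_. a) (\<lambda>_. y) (\<lambda>_. z) (\<lambda>_. w) u =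
       \<eta> c u a *\<^sub>R curvature (g c) (\<lambda>_. y) (\<lambda>_. z) (\<lambda>_. w) u"
      using \<eta>[OF smooth_on_const smooth_on_const smooth_on_const smooth_on_const] u sub by blast
  qed
  show "mean_curvature c x N u = 0" using mean[OF u] half_trace_shape_eq_0[OF u] by simp
qed

end
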